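(* If $\Omega\subset\mathbb{R}^n$ $(n\ge3)$ is a hyperconvex domain, then any conformal harmonic map $\mathbb{D}^*\to\Omega$ extends to a conformal harmonic map $\mathbb{D}\to\Omega$. In particular, $\Omega$ does not contain any nonconstant conformal minimal surface $M\to\Omega$ such that $M$ is the complement of finitely many points in a compact Riemann surface.
   Context: A domain is a nonempty connected open set. $\mathbb{D}=\{z=x+iy\in\mathbb{C}:|z|<1\}$ and $\mathbb{D}^*=\mathbb{D}\setminus\{0\}$. A $C^1$ map $f$ from an open subset of $\mathbb{R}^2=\mathbb{C}$ to $\mathbb{R}^n$ is conformal if $|f_x|=|f_y|$ and $f_x\cdot f_y=0$ at every point (it need not be an immersion); conformal maps from a Riemann surface are defined by the same condition in local holomorphic coordinates. A conformal minimal surface $M\to\Omega$ (possibly branched) is a conformal harmonic map $M\to\Omega$ from a connected Riemann surface; compact Riemann surfaces are without boundary. An upper-semicontinuous function $u:\Omega\to[-\infty,+\infty)$ is minimal plurisubharmonic (MPSH) if for every affine $2$-plane $L\subset\mathbb{R}^n$ the restriction of $u$ to $L\cap\Omega$ is subharmonic in conformal linear coordinates on $L$. A domain $\Omega\subset\mathbb{R}^n$ $(n\ge 3)$ is hyperconvex if it admits a continuous negative MPSH exhaustion function $u:\Omega\to[-\infty,0)$, where exhaustion means that $\{\mathbf{x}\in\Omega:u(\mathbf{x})\le t\}$ is compact for every $t<0$. *)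

theory Defs
  imports "HOL-Analysis.Analysis"
begin

definition dx :: "(complex \<Rightarrow> 'b::real_normed_vector) \<Rightarrow> complex \<Rightarrow> 'b" where
  "dx f z = frechet_derivative f (at z) 1"

definition dy :: "(complex \<Rightarrow> 'b::real_normed_vector) \<Rightarrow> complex \<Rightarrow> 'b" where
  "dy f z = frechet_derivative f (at z) \<i>"

definition C1_on :: "complex set \<Rightarrow> (complex \<Rightarrow> 'b::real_normed_vector) \<Rightarrow> bool" where
  "C1_on U f \<longleftrightarrow>
     (\<forall>z\<in>U. f differentiable (at z)) \<and> continuous_on U (dx f) \<and> continuous_on U (dy f)"

text \<open>For open \<open>U\<close>: of class \<open>C\<^sup>2\<close> with vanishing Laplacian.\<close>

definition harmonic_on :: "complex set \<Rightarrow> (complex \<Rightarrow> 'b::real_normed_vector) \<Rightarrow> bool" where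
  "harmonic_on U f \<longleftrightarrow>
     C1_on U f \<and> C1_on U (dx f) \<and> C1_on U (dy f) \<and>
     (\<forall>z\<in>U. dx (dx f) z + dy (dy f) z = 0)"

definition conformal_on :: "complex set \<Rightarrow> (complex \<Rightarrow> real ^ 'n) \<Rightarrow> bool" where
  "conformal_on U f \<longleftrightarrow>
     C1_on U f \<and> (\<forall>z\<in>U. norm (dx f z) = norm (dy f z) \<and> dx f z \<bullet> dy f z = 0)"

definition conformal_harmonic_map ::
    "complex set \<Rightarrow> (real ^ 'n) set \<Rightarrow> (complex \<Rightarrow> real ^ 'n) \<Rightarrow> bool" where
  "conformal_harmonic_map U \<Omega> f \<longleftrightarrow> conformal_on U f \<and> harmonic_on U f \<and> f \<in> U \<rightarrow> \<Omega>"

definition is_domain :: "'a::topological_space set \<Rightarrow> bool" where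
  "is_domain \<Omega> \<longleftrightarrow> \<Omega> \<noteq> {} \<and> connected \<Omega> \<and> open \<Omega>"

text \<open>Upper semicontinuous functions with values in \<open>[-\<infinity>, +\<infinity>)\<close>.\<close>

definition usc_on :: "'a::topological_space set \<Rightarrow> ('a \<Rightarrow> ereal) \<Rightarrow> bool" where
  "usc_on S u \<longleftrightarrow>
     (\<forall>x\<in>S. u x < \<infinity>) \<and> (\<forall>c. openin (top_of_set S) {x \<in> S. u x < c})"

text \<open>The definition by harmonic majorants on compact sets (as in Hoermander's textbook on several
  complex variables); the function identically \<open>-\<infinity>\<close> counts as subharmonic.\<close>

definition subharmonic_on :: "complex set \<Rightarrow> (complex \<Rightarrow> ereal) \<Rightarrow> bool" where
  "subharmonic_on U u \<longleftrightarrow>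
     usc_on U u \<and>
     (\<forall>K h. compact K \<longrightarrow> K \<subseteq> U \<longrightarrow> continuous_on K h \<longrightarrow> harmonic_on (interior K) h \<longrightarrow>
        (\<forall>z\<in>frontier K. u z \<le> ereal (h z)) \<longrightarrow> (\<forall>z\<in>K. u z \<le> ereal (h z)))"

text \<open>For \<open>norm v = norm w \<noteq> 0\<close> and \<open>v \<bullet> w = 0\<close>, the maps \<open>plane_coord p v w\<close> are exactly the
  conformal linear parametrizations of the affine 2-planes.\<close>

definition plane_coord :: "real ^ 'n \<Rightarrow> real ^ 'n \<Rightarrow> real ^ 'n \<Rightarrow> complex \<Rightarrow> real ^ 'n" where
  "plane_coord p v w z = p + Re z *\<^sub>R v + Im z *\<^sub>R w"

definition MPSH_on :: "(real ^ 'n) set \<Rightarrow> (real ^ 'n \<Rightarrow> ereal) \<Rightarrow> bool" where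
  "MPSH_on \<Omega> u \<longleftrightarrow>
     usc_on \<Omega> u \<and>
     (\<forall>p v w. norm v = norm w \<longrightarrow> v \<noteq> 0 \<longrightarrow> v \<bullet> w = 0 \<longrightarrow>
        subharmonic_on (plane_coord p v w -` \<Omega>) (u \<circ> plane_coord p v w))"

definition hyperconvex :: "(real ^ 'n) set \<Rightarrow> bool" where
  "hyperconvex \<Omega> \<longleftrightarrow>
     (\<exists>u. continuous_on \<Omega> u \<and> MPSH_on \<Omega> u \<and> (\<forall>x\<in>\<Omega>. u x < 0) \<and>
          (\<forall>t::real. t < 0 \<longrightarrow> compact {x \<in> \<Omega>. u x \<le> ereal t}))"

text \<open>A Riemann surface is a connected Hausdorff space \<open>X\<close> with a (not necessarily maximal) atlas
  of charts \<open>(U, \<phi>)\<close>, where \<open>\<phi>\<close> is only relevant on \<open>U\<close>, with holomorphic transition maps.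
  Second countability is automatic (Rado).\<close>

type_synonym 'x atlas = "('x set \<times> ('x \<Rightarrow> complex)) set"

definition riemann_surface :: "'x topology \<Rightarrow> 'x atlas \<Rightarrow> bool" where
  "riemann_surface X \<A> \<longleftrightarrow>
     topspace X \<noteq> {} \<and> connected_space X \<and> Hausdorff_space X \<and>
     (\<Union>(U, \<phi>)\<in>\<A>. U) = topspace X \<and>
     (\<forall>(U, \<phi>)\<in>\<A>. openin X U \<and> open (\<phi> ` U) \<and>
        homeomorphic_map (subtopology X U) (top_of_set (\<phi> ` U)) \<phi>) \<and>
     (\<forall>(U, \<phi>)\<in>\<A>. \<forall>(V, \<psi>)\<in>\<A>. (\<psi> \<circ> inv_into U \<phi>) holomorphic_on \<phi> ` (U \<inter> V))"

definition restrict_atlas :: "'x set \<Rightarrow> 'x atlas \<Rightarrow> 'x atlas" where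
  "restrict_atlas S \<A> = (\<lambda>(U, \<phi>). (U \<inter> S, \<phi>)) ` \<A>"

definition conformal_minimal_surface ::
    "'x topology \<Rightarrow> 'x atlas \<Rightarrow> (real ^ 'n) set \<Rightarrow> ('x \<Rightarrow> real ^ 'n) \<Rightarrow> bool" where
  "conformal_minimal_surface M \<A> \<Omega> f \<longleftrightarrow>
     riemann_surface M \<A> \<and> f \<in> topspace M \<rightarrow> \<Omega> \<and>
     (\<forall>(U, \<phi>)\<in>\<A>. conformal_harmonic_map (\<phi> ` U) \<Omega> (f \<circ> inv_into U \<phi>))"

end

theory Submission
  imports Defs "HOL-Complex_Analysis.Complex_Analysis"
begin

text \<open>Let \<open>u\<close> be a negative MPSH exhaustion of \<open>\<Omega>\<close> and \<open>f\<close> conformal harmonic on the punctured disc. Then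
  \<open>u \<circ> f\<close> is subharmonic and bounded above, so near the puncture it is at most its maximum \<open>t < 0\<close> on a
  circle. Hence \<open>f\<close> stays near the puncture in the compact set \<open>{u \<le> t}\<close>, is bounded, and extends
  harmonically with its value at the puncture in that set. For a punctured compact Riemann surface,
  extending across every puncture gives a harmonic map on a compact connected surface, whose
  components are constant by the maximum principle.\<close>

subsection \<open>Harmonic functions\<close>

text \<open>The delicate point is the subharmonicity of \<open>u \<circ> f\<close>. An MPSH function
  is tested only on affine planes, whereas the image of \<open>f\<close> is curved, and
  \<open>u\<close> is merely continuous and may take the value -\<infinity>, so no chain rule is
  available. Conformality of \<open>f\<close> supplies the plane: up to an error o(r) on the circle
  of radius r, \<open>f\<close> is a conformal linear parametrization of its tangent plane, and
  where the differential vanishes any sufficiently contracted orthogonal parametrization serves. The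
  harmonic function theory is reduced to holomorphic functions. The complex gradient of a real
  harmonic function is holomorphic, so its pullback to a convex open set has a primitive. This makes
  Riemann's removable singularity theorem and the maximum modulus principle available. A bounded
  extension could still send the puncture to the boundary of \<Omega>; compactness of the sublevel
  set excludes this. Conformality at the puncture passes to the limit because the partial
  derivatives of the extension are continuous.\<close>

lemma differentiable_has_derivative:
  assumes "f differentiable (at z)"
  shows "(f has_derivative (\<lambda>h. Re h *\<^sub>R dx f z + Im h *\<^sub>R dy f z)) (at z)"
proof -
  let ?D = "frechet_derivative f (at z)"
  have D: "(f has_derivative ?D) (at z)" using assms frechet_derivative_works by blast
  then have l: "linear ?D" by (rule has_derivative_linear)
  have "?D h = Re h *\<^sub>R dx f z + Im h *\<^sub>R dy f z" for h
  proof -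
    have "h = Re h *\<^sub>R 1 + Im h *\<^sub>R \<i>" by (simp add: complex_eq_iff)
    then have "?D h = ?D (Re h *\<^sub>R 1 + Im h *\<^sub>R \<i>)" by simp
    also have "\<dots> = Re h *\<^sub>R ?D 1 + Im h *\<^sub>R ?D \<i>"
      by (simp only: linear_add[OF l] linear_scale[OF l])
    finally show ?thesis by (simp add: dx_def dy_def)
  qed
  then have "?D = (\<lambda>h. Re h *\<^sub>R dx f z + Im h *\<^sub>R dy f z)" by auto
  with D show ?thesis by simp
qed

lemma has_derivative_dx_dy:
  assumes "(f has_derivative (\<lambda>h. Re h *\<^sub>R a + Im h *\<^sub>R b)) (at z)"
  shows "f differentiable (at z)" "dx f z = a" "dy f z = b"
proof -
  show "f differentiable (at z)" using assms differentiableI by blast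
  have "frechet_derivative f (at z) = (\<lambda>h. Re h *\<^sub>R a + Im h *\<^sub>R b)"
    using frechet_derivative_at[OF assms] by simp
  then show "dx f z = a" "dy f z = b" by (simp_all add: dx_def dy_def)
qed

lemma C1_onI:
  assumes "\<And>z. z \<in> U \<Longrightarrow> (f has_derivative (\<lambda>h. Re h *\<^sub>R p z + Im h *\<^sub>R q z)) (at z)"
    and "continuous_on U p" "continuous_on U q"
  shows "C1_on U f"
proof -
  have "f differentiable (at z)" "p z = dx f z" "q z = dy f z" if "z \<in> U" for z
    using has_derivative_dx_dy[OF assms(1)[OF that]] by auto
  then show ?thesis
    using assms(2,3) by (simp add: C1_on_def cong: continuous_on_cong)
qed

lemma has_derivative_transform_open:
  assumes "(f has_derivative D) (at z)" "open U" "z \<in> U" "\<And>w. w \<in> U \<Longrightarrow> f w = g w"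
  shows "(g has_derivative D) (at z)"
  using has_derivative_transform_within_open[OF assms(1-3)] assms(4) by blast

lemma C1_on_has_derivative:
  "C1_on U f \<Longrightarrow> z \<in> U \<Longrightarrow> (f has_derivative (\<lambda>h. Re h *\<^sub>R dx f z + Im h *\<^sub>R dy f z)) (at z)"
  unfolding C1_on_def by (simp add: differentiable_has_derivative)

text \<open>The partial derivatives are supplied as explicit functions known only on
  \<open>U\<close>. Openness of \<open>U\<close> turns the agreement of \<open>dx f\<close> with
  \<open>p\<close> there into agreement near each point, so that the second derivatives can be
  transferred.\<close>

lemma harmonic_onI:
  fixes f :: "complex \<Rightarrow> 'b::real_normed_vector"
  assumes U: "open U"
    and f: "\<And>z. z \<in> U \<Longrightarrow> (f has_derivative (\<lambda>h. Re h *\<^sub>R p z + Im h *\<^sub>R q z)) (at z)"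
    and p: "\<And>z. z \<in> U \<Longrightarrow> (p has_derivative (\<lambda>h. Re h *\<^sub>R pp z + Im h *\<^sub>R pq z)) (at z)"
    and q: "\<And>z. z \<in> U \<Longrightarrow> (q has_derivative (\<lambda>h. Re h *\<^sub>R qp z + Im h *\<^sub>R qq z)) (at z)"
    and c: "continuous_on U pp" "continuous_on U pq" "continuous_on U qp" "continuous_on U qq"
    and l: "\<And>z. z \<in> U \<Longrightarrow> pp z + qq z = 0"
  shows "harmonic_on U f"
proof -
  have cp: "continuous_on U p" "continuous_on U q"
    using has_derivative_continuous_on[OF has_derivative_at_withinI[OF p]]
      has_derivative_continuous_on[OF has_derivative_at_withinI[OF q]] by auto
  have dx: "dx f z = p z" and dy: "dy f z = q z" if "z \<in> U" for z
    using has_derivative_dx_dy[OF f[OF that]] by auto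
  have dp: "(dx f has_derivative (\<lambda>h. Re h *\<^sub>R pp z + Im h *\<^sub>R pq z)) (at z)" if "z \<in> U" for z
    using has_derivative_transform_open[OF p[OF that] U that] dx by simp
  have dq: "(dy f has_derivative (\<lambda>h. Re h *\<^sub>R qp z + Im h *\<^sub>R qq z)) (at z)" if "z \<in> U" for z
    using has_derivative_transform_open[OF q[OF that] U that] dy by simp
  show ?thesis unfolding harmonic_on_def
    using C1_onI[OF f cp] C1_onI[OF dp c(1,2)] C1_onI[OF dq c(3,4)]
      has_derivative_dx_dy[OF dp] has_derivative_dx_dy[OF dq] l by auto
qed

text \<open>The facts come in the order of the premises of \<open>harmonic_onI\<close>, so that a
  closure proof can pass them through one by one.\<close>

lemma harmonic_onD:
  assumes "harmonic_on U f"
  obtains "\<And>z. z \<in> U \<Longrightarrow> (f has_derivative (\<lambda>h. Re h *\<^sub>R dx f z + Im h *\<^sub>R dy f z)) (at z)"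
    "\<And>z. z \<in> U \<Longrightarrow> (dx f has_derivative (\<lambda>h. Re h *\<^sub>R dx (dx f) z + Im h *\<^sub>R dy (dx f) z)) (at z)"
    "\<And>z. z \<in> U \<Longrightarrow> (dy f has_derivative (\<lambda>h. Re h *\<^sub>R dx (dy f) z + Im h *\<^sub>R dy (dy f) z)) (at z)"
    "continuous_on U (dx (dx f))" "continuous_on U (dy (dx f))"
    "continuous_on U (dx (dy f))" "continuous_on U (dy (dy f))"
    "\<And>z. z \<in> U \<Longrightarrow> dx (dx f) z + dy (dy f) z = 0"
  using assms unfolding harmonic_on_def by (auto simp: C1_on_has_derivative) (auto simp: C1_on_def)

lemma harmonic_on_imp_continuous_on: "harmonic_on U f \<Longrightarrow> continuous_on U f"
  by (erule harmonic_onD) (rule has_derivative_continuous_on[OF has_derivative_at_withinI])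

lemma harmonic_on_cong:
  assumes "harmonic_on U f" "open U" "\<And>z. z \<in> U \<Longrightarrow> f z = g z"
  shows "harmonic_on U g"
proof -
  from assms(1) show ?thesis
  proof (rule harmonic_onD, goal_cases)
    case 1
    show ?case
      by (rule harmonic_onI[OF assms(2) has_derivative_transform_open[OF 1(1) assms(2) _ assms(3)] 1(2-)])
  qed
qed

section \<open>Closure properties of harmonic maps\<close>

lemma harmonic_on_subset: "harmonic_on U f \<Longrightarrow> V \<subseteq> U \<Longrightarrow> harmonic_on V f"
  unfolding harmonic_on_def C1_on_def by (meson continuous_on_subset subsetD)

text \<open>One rule for real parts, components, negation, constant multiples and inner products
  with a fixed vector.\<close>

lemma harmonic_on_bounded_linear:
  assumes f: "harmonic_on U f" and U: "open U" and T: "bounded_linear T"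
  shows "harmonic_on U (\<lambda>z. T (f z))"
proof -
  interpret bounded_linear T by fact
  have D: "((\<lambda>z. T (g z)) has_derivative (\<lambda>h. Re h *\<^sub>R T a + Im h *\<^sub>R T b)) (at z)"
    if "(g has_derivative (\<lambda>h. Re h *\<^sub>R a + Im h *\<^sub>R b)) (at z)" for g a b z
    using has_derivative[OF that] by (simp add: add scaleR)
  from f show ?thesis
  proof (rule harmonic_onD, goal_cases)
    case 1
    show ?case
      by (rule harmonic_onI[OF U D[OF 1(1)] D[OF 1(2)] D[OF 1(3)] continuous_on[OF 1(4)]
            continuous_on[OF 1(5)] continuous_on[OF 1(6)] continuous_on[OF 1(7)]])
        (auto simp: 1(8) zero simp flip: add)
  qed
qed

lemma harmonic_on_add:
  assumes f: "harmonic_on U f" and g: "harmonic_on U g" and U: "open U"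
  shows "harmonic_on U (\<lambda>z. f z + g z)"
proof -
  have D: "((\<lambda>z. f z + g z) has_derivative (\<lambda>h. Re h *\<^sub>R (a + c) + Im h *\<^sub>R (b + d))) (at z)"
    if "(f has_derivative (\<lambda>h. Re h *\<^sub>R a + Im h *\<^sub>R b)) (at z)"
     "(g has_derivative (\<lambda>h. Re h *\<^sub>R c + Im h *\<^sub>R d)) (at z)" for f g a b c d z
    using has_derivative_add[OF that] by (simp add: algebra_simps)
  from f show ?thesis
  proof (rule harmonic_onD, goal_cases)
    case 1
    from g show ?case 
    proof (rule harmonic_onD, goal_cases)
      case 2: 1
      show ?case
        by (rule harmonic_onI[OF U D[OF 1(1) 2(1)] D[OF 1(2) 2(2)] D[OF 1(3) 2(3)]])
          (use 1(4-8) 2(4-8) in \<open>auto intro!: continuous_intros simp: add_eq_0_iff\<close>)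
    qed
  qed
qed

lemma harmonic_on_const: "open U \<Longrightarrow> harmonic_on U (\<lambda>z. c)"
  by (rule harmonic_onI[where p="\<lambda>_. 0" and q="\<lambda>_. 0" and pp="\<lambda>_. 0" and pq="\<lambda>_. 0"
        and qp="\<lambda>_. 0" and qq="\<lambda>_. 0"]) auto

lemma harmonic_on_diff:
  assumes f: "harmonic_on U f" and g: "harmonic_on U g" and U: "open U"
  shows "harmonic_on U (\<lambda>z. f z - g z)"
  using harmonic_on_add[OF f harmonic_on_bounded_linear[OF g U bounded_linear_minus[OF bounded_linear_ident]] U]
  by simp

lemma harmonic_on_sum:
  assumes "\<And>i. i \<in> I \<Longrightarrow> harmonic_on U (f i)" and U: "open U"
  shows "harmonic_on U (\<lambda>z. \<Sum>i\<in>I. f i z)"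
  using assms(1)
  by (induction I rule: infinite_finite_induct) (auto intro: harmonic_on_const[OF U] harmonic_on_add U)

lemma harmonic_on_vec:
  fixes f :: "complex \<Rightarrow> real ^ 'n"
  assumes f: "\<And>i. harmonic_on U (\<lambda>z. f z $ i)" and U: "open U"
  shows "harmonic_on U f"
proof -
  have "harmonic_on U (\<lambda>z. \<Sum>i\<in>UNIV. (f z $ i) *\<^sub>R axis i 1)"
    by (intro harmonic_on_sum U harmonic_on_bounded_linear[OF f U] bounded_linear_scaleR_left)
  moreover have "(\<lambda>z. \<Sum>i\<in>UNIV. (f z $ i) *\<^sub>R axis i 1) = f"
    by (simp add: fun_eq_iff vec_eq_iff axis_def if_distrib cong: if_cong)
  ultimately show ?thesis by (rule back_subst[of "harmonic_on U"])
qed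

lemma harmonic_on_nth:
  fixes f :: "complex \<Rightarrow> real ^ 'n"
  assumes "harmonic_on U f" "open U"
  shows "harmonic_on U (\<lambda>z. f z $ i)"
  by (rule harmonic_on_bounded_linear[OF assms bounded_linear_vec_nth])

text \<open>The partial derivatives of g are g' and i g', so the Laplacian is g'' + i^2 g'' =
  0.\<close>

lemma holomorphic_imp_harmonic_on:
  assumes g: "g holomorphic_on U" and U: "open U"
  shows "harmonic_on U g"
proof (rule harmonic_onI[OF U])
  have D: "(k has_derivative (\<lambda>h. Re h *\<^sub>R deriv k z + Im h *\<^sub>R (\<i> * deriv k z))) (at z)"
    if "k holomorphic_on U" "z \<in> U" for k z
  proof -
    have "(k has_derivative (*) (deriv k z)) (at z)"
      using holomorphic_derivI[OF that(1) U that(2)] by (simp add: has_field_derivative_def)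
    moreover have "(*) (deriv k z) = (\<lambda>h. Re h *\<^sub>R deriv k z + Im h *\<^sub>R (\<i> * deriv k z))"
      by (auto simp: complex_eq_iff algebra_simps)
    ultimately show ?thesis by simp
  qed
  have 1: "deriv g holomorphic_on U" by (intro holomorphic_deriv g U)
  have 2: "deriv (deriv g) holomorphic_on U" by (intro holomorphic_deriv g U)
  note c = holomorphic_on_imp_continuous_on[OF 2]
  show "(g has_derivative (\<lambda>h. Re h *\<^sub>R deriv g z + Im h *\<^sub>R (\<i> * deriv g z))) (at z)" if "z \<in> U" for z
    by (rule D[OF g that])
  show "(deriv g has_derivative (\<lambda>h. Re h *\<^sub>R deriv (deriv g) z + Im h *\<^sub>R (\<i> * deriv (deriv g) z))) (at z)"
    if "z \<in> U" for z by (rule D[OF 1 that])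
  show "((\<lambda>z. \<i> * deriv g z) has_derivative
      (\<lambda>h. Re h *\<^sub>R (\<i> * deriv (deriv g) z) + Im h *\<^sub>R (- deriv (deriv g) z))) (at z)"
    if "z \<in> U" for z
    using has_derivative_mult_right[OF D[OF 1 that], of \<i>] by (simp add: algebra_simps)
  show "continuous_on U (deriv (deriv g))" "continuous_on U (\<lambda>z. \<i> * deriv (deriv g) z)"
    "continuous_on U (\<lambda>z. \<i> * deriv (deriv g) z)" "continuous_on U (\<lambda>z. - deriv (deriv g) z)"
    by (intro continuous_intros c)+
qed auto

lemma holomorphic_imp_harmonic_on_Re:
  "g holomorphic_on U \<Longrightarrow> open U \<Longrightarrow> harmonic_on U (\<lambda>z. Re (g z))"
  by (intro harmonic_on_bounded_linear[OF holomorphic_imp_harmonic_on] bounded_linear_Re)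

text \<open>Real dilations and translations multiply the Laplacian by r^2. They serve to recentre at
  a point and to rescale a coordinate disc to the unit disc.\<close>

lemma harmonic_on_affine:
  fixes r :: real
  assumes f: "harmonic_on V f" and V: "open V"
  shows "harmonic_on ((\<lambda>z. c + r *\<^sub>R z) -` V) (\<lambda>z. f (c + r *\<^sub>R z))"
proof -
  let ?A = "\<lambda>z. c + r *\<^sub>R z"
  have D: "((\<lambda>z. r *\<^sub>R g (?A z)) has_derivative (\<lambda>h. Re h *\<^sub>R r *\<^sub>R r *\<^sub>R a + Im h *\<^sub>R r *\<^sub>R r *\<^sub>R b)) (at z)"
    if "(g has_derivative (\<lambda>h. Re h *\<^sub>R a + Im h *\<^sub>R b)) (at (?A z))" for g z and a b :: 'a
    by (rule has_derivative_eq_rhs, rule has_derivative_scaleR_right,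
        rule has_derivative_compose[where f="?A" and g=g, OF _ that])
      (auto intro!: derivative_eq_intros simp: algebra_simps)
  have D0: "((\<lambda>z. g (?A z)) has_derivative (\<lambda>h. Re h *\<^sub>R r *\<^sub>R a + Im h *\<^sub>R r *\<^sub>R b)) (at z)"
    if "(g has_derivative (\<lambda>h. Re h *\<^sub>R a + Im h *\<^sub>R b)) (at (?A z))" for g z and a b :: 'a
    by (rule has_derivative_eq_rhs, 
        rule has_derivative_compose[where f="?A" and g=g, OF _ that])
      (auto intro!: derivative_eq_intros simp: algebra_simps)
  have cA: "continuous_on S ?A" for S by (intro continuous_intros)
  have C: "continuous_on (?A -` V) (\<lambda>z. r *\<^sub>R r *\<^sub>R g (?A z))" if "continuous_on V g" for g :: "complex \<Rightarrow> 'a"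
    by (intro continuous_intros continuous_on_compose2[OF that cA]) auto
  have oV: "open (?A -` V)" using V by (intro continuous_open_vimage cA) (simp_all add: continuous_intros)
  from f show ?thesis
  proof (rule harmonic_onD, goal_cases)
    case 1
    show ?case
    proof (rule harmonic_onI[OF oV D0[OF 1(1)] D[OF 1(2)] D[OF 1(3)] C[OF 1(4)] C[OF 1(5)] C[OF 1(6)] C[OF 1(7)]])
      fix z assume "z \<in> ?A -` V"
      then have "dx (dx f) (?A z) + dy (dy f) (?A z) = 0" using 1(8) by simp
      then show "r *\<^sub>R r *\<^sub>R dx (dx f) (?A z) + r *\<^sub>R r *\<^sub>R dy (dy f) (?A z) = 0"
        by (metis scaleR_add_right scaleR_zero_right)
    qed auto
  qed
qed

lemma conformal_harmonic_map_affine: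
  fixes r :: real
  assumes f: "conformal_harmonic_map V \<Omega> f" and V: "open V"
  shows "conformal_harmonic_map ((\<lambda>z. c + r *\<^sub>R z) -` V) \<Omega> (\<lambda>z. f (c + r *\<^sub>R z))"
proof -
  let ?A = "\<lambda>z. c + r *\<^sub>R z"
  have h: "harmonic_on (?A -` V) (\<lambda>z. f (c + r *\<^sub>R z))"
    using f V harmonic_on_affine unfolding conformal_harmonic_map_def by blast
  have C1: "C1_on V f" using f unfolding conformal_harmonic_map_def conformal_on_def by blast
  have "dx (\<lambda>z. f (?A z)) z = r *\<^sub>R dx f (?A z) \<and> dy (\<lambda>z. f (?A z)) z = r *\<^sub>R dy f (?A z)" if "?A z \<in> V" for z
  proof -
    have "((\<lambda>z. f (?A z)) has_derivative (\<lambda>h. Re h *\<^sub>R r *\<^sub>R dx f (?A z) + Im h *\<^sub>R r *\<^sub>R dy f (?A z))) (at z)"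
    by (rule has_derivative_eq_rhs, 
        rule has_derivative_compose[where f="?A" and g=f, OF _ C1_on_has_derivative[OF C1 that]])
      (auto intro!: derivative_eq_intros simp: algebra_simps)
    then show ?thesis using has_derivative_dx_dy by blast
  qed
  then show ?thesis using f h unfolding conformal_harmonic_map_def conformal_on_def
    by (auto simp: harmonic_on_def)
qed

subsection \<open>Real harmonic functions as real parts\<close>

text \<open>The mean value theorem is applied first along \<open>u\<close>, to the increment of
  \<open>f\<close> in the direction \<open>v\<close>, and then along \<open>v\<close>, to the
  derivative in the direction \<open>u\<close>. Keeping both directions general allows them to be
  exchanged afterwards.\<close>

lemma second_difference_mvt:
  fixes f p :: "complex \<Rightarrow> real"
  assumes r: "0 < r" and h: "norm u \<le> 1" "norm v \<le> 1"
    and f: "\<And>w. w \<in> ball z r \<Longrightarrow> (f has_derivative D w) (at w)"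
    and p: "\<And>w. w \<in> ball z r \<Longrightarrow> ((\<lambda>w. D w u) has_derivative E w) (at w)"
    and t: "0 < t" "2 * t < r"
  obtains \<sigma> \<tau> where "0 < \<sigma>" "\<sigma> < t" "0 < \<tau>" "\<tau> < t"
    "f (z + t *\<^sub>R u + t *\<^sub>R v) - f (z + t *\<^sub>R u) - f (z + t *\<^sub>R v) + f z = t * t * E (z + \<sigma> *\<^sub>R u + \<tau> *\<^sub>R v) v"
proof -
  have inb: "z + s *\<^sub>R u + s' *\<^sub>R v \<in> ball z r" if "0 \<le> s" "s \<le> t" "0 \<le> s'" "s' \<le> t" for s s'
  proof -
    have "norm (s *\<^sub>R u + s' *\<^sub>R v) \<le> s * norm u + s' * norm v"
      by (rule order_trans[OF norm_triangle_ineq]) (use that in simp)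
    also have "\<dots> \<le> s * 1 + s' * 1" by (intro add_mono mult_left_mono h that)
    finally have "norm (s *\<^sub>R u + s' *\<^sub>R v) < r" using that t by simp
    moreover have "dist z (z + s *\<^sub>R u + s' *\<^sub>R v) = norm (s *\<^sub>R u + s' *\<^sub>R v)"
      by (subst dist_commute) (simp add: dist_norm add.assoc)
    ultimately show ?thesis by (simp only: mem_ball)
  qed
  have 1: "((\<lambda>s. f (z + s *\<^sub>R u + s' *\<^sub>R v)) has_real_derivative D (z + s *\<^sub>R u + s' *\<^sub>R v) u) (at s)"
    if "0 \<le> s" "s \<le> t" "0 \<le> s'" "s' \<le> t" for s s'
  proof -
    note d = f[OF inb[OF that]]
    have "((\<lambda>s. f (z + s *\<^sub>R u + s' *\<^sub>R v)) has_derivative (\<lambda>k. D (z + s *\<^sub>R u + s' *\<^sub>R v) (k *\<^sub>R u))) (at s)"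
      by (rule has_derivative_compose[where f="\<lambda>s. z + s *\<^sub>R u + s' *\<^sub>R v" and g=f, OF _ d])
        (auto intro!: derivative_eq_intros)
    then show ?thesis unfolding has_field_derivative_def
      by (simp add: linear_scale[OF has_derivative_linear[OF d]] mult.commute[of _ "D _ u"])
  qed
  \<comment> \<open>The terms with coefficient 0 give all four values of \<open>f\<close> the shape
    required by fact \<open>1\<close>.\<close>
  have "\<exists>\<sigma>. 0 < \<sigma> \<and> \<sigma> < t \<and> (f (z + t *\<^sub>R u + t *\<^sub>R v) - f (z + t *\<^sub>R u + 0 *\<^sub>R v)) - 
     (f (z + 0 *\<^sub>R u + t *\<^sub>R v) - f (z + 0 *\<^sub>R u + 0 *\<^sub>R v)) = 
      (t - 0) * (D (z + \<sigma> *\<^sub>R u + t *\<^sub>R v) u - D (z + \<sigma> *\<^sub>R u + 0 *\<^sub>R v) u)"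
    by (rule MVT2[OF t(1)]) (intro DERIV_diff 1, use t in auto)
  then obtain \<sigma> where \<sigma>: "0 < \<sigma>" "\<sigma> < t" "(f (z + t *\<^sub>R u + t *\<^sub>R v) - f (z + t *\<^sub>R u)) - 
     (f (z + t *\<^sub>R v) - f z) = 
      t * (D (z + \<sigma> *\<^sub>R u + t *\<^sub>R v) u - D (z + \<sigma> *\<^sub>R u + 0 *\<^sub>R v) u)" by auto
  have 2: "((\<lambda>s'. D (z + \<sigma> *\<^sub>R u + s' *\<^sub>R v) u) has_real_derivative E (z + \<sigma> *\<^sub>R u + s' *\<^sub>R v) v) (at s')"
    if "0 \<le> s'" "s' \<le> t" for s'
  proof -
    have "z + \<sigma> *\<^sub>R u + s' *\<^sub>R v \<in> ball z r" using inb \<sigma> that by simp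
    note d = p[OF this]
    have "((\<lambda>s. D (z + \<sigma> *\<^sub>R u + s *\<^sub>R v) u) has_derivative (\<lambda>k. E (z + \<sigma> *\<^sub>R u + s' *\<^sub>R v) (k *\<^sub>R v))) (at s')"
      by (rule has_derivative_compose[where f="\<lambda>s. z + \<sigma> *\<^sub>R u + s *\<^sub>R v" and g="\<lambda>w. D w u", OF _ d])
        (auto intro!: derivative_eq_intros)
    then show ?thesis unfolding has_field_derivative_def
      by (simp add: linear_scale[OF has_derivative_linear[OF d]] mult.commute[of _ "E _ v"])
  qed
  have "\<exists>\<tau>. 0 < \<tau> \<and> \<tau> < t \<and> D (z + \<sigma> *\<^sub>R u + t *\<^sub>R v) u - D (z + \<sigma> *\<^sub>R u + 0 *\<^sub>R v) u
     = (t - 0) * E (z + \<sigma> *\<^sub>R u + \<tau> *\<^sub>R v) v"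
    by (rule MVT2[OF t(1)]) (rule 2)
  then obtain \<tau> where "0 < \<tau>" "\<tau> < t" "D (z + \<sigma> *\<^sub>R u + t *\<^sub>R v) u - D (z + \<sigma> *\<^sub>R u + 0 *\<^sub>R v) u
     = t * E (z + \<sigma> *\<^sub>R u + \<tau> *\<^sub>R v) v" by auto
  with \<sigma> show ?thesis by (intro that[of \<sigma> \<tau>]) auto
qed

text \<open>Schwarz's theorem: the second difference is symmetric in the two directions and equals
  t^2 times either mixed partial at some nearby point, so continuity forces the two to
  agree.\<close>

lemma mixed_partials_eq:
  fixes f :: "complex \<Rightarrow> real"
  assumes U: "open U" "z \<in> U" and f: "C1_on U f" "C1_on U (dx f)" "C1_on U (dy f)"
  shows "dy (dx f) z = dx (dy f) z"
proof (rule ccontr)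
  assume ne: "dy (dx f) z \<noteq> dx (dy f) z"
  \<comment> \<open>Half the gap: values closer than \<open>e\<close> to the two mixed partials
    cannot coincide.\<close>
  define e where "e = \<bar>dy (dx f) z - dx (dy f) z\<bar> / 2"
  have e: "e > 0" using ne by (simp add: e_def)
  have "isCont (dy (dx f)) z" "isCont (dx (dy f)) z"
    using f U continuous_on_eq_continuous_at unfolding C1_on_def by blast+
  then obtain d1 d2 where d: "d1 > 0" "\<And>w. dist w z < d1 \<Longrightarrow> dist (dy (dx f) w) (dy (dx f) z) < e"
    "d2 > 0" "\<And>w. dist w z < d2 \<Longrightarrow> dist (dx (dy f) w) (dx (dy f) z) < e"
    using e unfolding continuous_at_eps_delta by metis
  obtain r0 where r0: "r0 > 0" "ball z r0 \<subseteq> U" using U openE by blast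
  define r where "r = min r0 (min d1 d2)"
  have r: "r > 0" "ball z r \<subseteq> U" using r0 d by (auto simp: r_def)
  define t where "t = r / 3"
  have t: "0 < t" "2 * t < r" using r by (auto simp: t_def)
  have D: "\<And>w. w \<in> ball z r \<Longrightarrow> (f has_derivative (\<lambda>h. Re h *\<^sub>R dx f w + Im h *\<^sub>R dy f w)) (at w)"
    using r f(1) C1_on_has_derivative by blast
  have D1: "\<And>w. w \<in> ball z r \<Longrightarrow> ((\<lambda>w. Re 1 *\<^sub>R dx f w + Im 1 *\<^sub>R dy f w) has_derivative 
     (\<lambda>h. Re h *\<^sub>R dx (dx f) w + Im h *\<^sub>R dy (dx f) w)) (at w)"
    using r C1_on_has_derivative[OF f(2)] by auto
  have D2: "\<And>w. w \<in> ball z r \<Longrightarrow> ((\<lambda>w. Re \<i> *\<^sub>R dx f w + Im \<i> *\<^sub>R dy f w) has_derivative 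
     (\<lambda>h. Re h *\<^sub>R dx (dy f) w + Im h *\<^sub>R dy (dy f) w)) (at w)"
    using r C1_on_has_derivative[OF f(3)] by auto
  obtain s1 t1 where 1: "0 < s1" "s1 < t" "0 < t1" "t1 < t" 
    "f (z + t *\<^sub>R 1 + t *\<^sub>R \<i>) - f (z + t *\<^sub>R 1) - f (z + t *\<^sub>R \<i>) + f z = 
       t * t * (Re \<i> *\<^sub>R dx (dx f) (z + s1 *\<^sub>R 1 + t1 *\<^sub>R \<i>) + Im \<i> *\<^sub>R dy (dx f) (z + s1 *\<^sub>R 1 + t1 *\<^sub>R \<i>))"
    by (rule second_difference_mvt[OF r(1) _ _ D D1 t, of \<i>]) auto
  obtain s2 t2 where 2: "0 < s2" "s2 < t" "0 < t2" "t2 < t" 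
    "f (z + t *\<^sub>R \<i> + t *\<^sub>R 1) - f (z + t *\<^sub>R \<i>) - f (z + t *\<^sub>R 1) + f z = 
       t * t * (Re 1 *\<^sub>R dx (dy f) (z + s2 *\<^sub>R \<i> + t2 *\<^sub>R 1) + Im 1 *\<^sub>R dy (dy f) (z + s2 *\<^sub>R \<i> + t2 *\<^sub>R 1))"
    by (rule second_difference_mvt[OF r(1) _ _ D D2 t, of 1]) auto
  let ?w1 = "z + s1 *\<^sub>R 1 + t1 *\<^sub>R \<i>" and ?w2 = "z + s2 *\<^sub>R \<i> + t2 *\<^sub>R 1"
  have sym: "f (z + t *\<^sub>R 1 + t *\<^sub>R \<i>) - f (z + t *\<^sub>R 1) - f (z + t *\<^sub>R \<i>) + f z =
      f (z + t *\<^sub>R \<i> + t *\<^sub>R 1) - f (z + t *\<^sub>R \<i>) - f (z + t *\<^sub>R 1) + f z"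
    by (simp add: add.commute add.left_commute)
  note trans[OF 1(5)[symmetric] trans[OF sym 2(5)]]
  then have eq: "dy (dx f) ?w1 = dx (dy f) ?w2" using t by simp
  have "norm (s1 *\<^sub>R 1 + t1 *\<^sub>R \<i>) < r" "norm (s2 *\<^sub>R \<i> + t2 *\<^sub>R 1) < r"
    by (rule le_less_trans[OF norm_triangle_ineq]; use 1 2 t in simp)+
  then have "dist ?w1 z < r" "dist ?w2 z < r" by (simp_all add: dist_norm add.assoc)
  then have "dist (dy (dx f) ?w1) (dy (dx f) z) < e" "dist (dx (dy f) ?w2) (dx (dy f) z) < e"
    using d by (auto simp: r_def)
  then show False using eq e by (simp add: e_def dist_real_def abs_if field_simps split: if_splits)
qed

text \<open>This is twice the Wirtinger derivative of \<open>f\<close>. Its Cauchy-Riemann equations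
  are the Laplace equation and the symmetry of the mixed partials.\<close>

lemma holomorphic_gradient:
  fixes f :: "complex \<Rightarrow> real"
  assumes U: "open U" and f: "harmonic_on U f"
  shows "(\<lambda>z. Complex (dx f z) (- dy f z)) holomorphic_on U"
proof -
  from f have C: "C1_on U f" "C1_on U (dx f)" "C1_on U (dy f)" "\<And>z. z \<in> U \<Longrightarrow> dx (dx f) z + dy (dy f) z = 0"
    by (auto simp: harmonic_on_def)
  let ?g = "\<lambda>z. Complex (dx f z) (- dy f z)"
  have "(?g has_field_derivative Complex (dx (dx f) z) (- dx (dy f) z)) (at z)" if z: "z \<in> U" for z
  proof -
    have g: "?g = (\<lambda>z. of_real (dx f z) - \<i> * of_real (dy f z))" by (auto simp: complex_eq_iff)
    have "(?g has_derivative (\<lambda>h. of_real (Re h *\<^sub>R dx (dx f) z + Im h *\<^sub>R dy (dx f) z)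
       - \<i> * of_real (Re h *\<^sub>R dx (dy f) z + Im h *\<^sub>R dy (dy f) z))) (at z)"
      unfolding g
      by (intro has_derivative_diff has_derivative_mult_right has_derivative_of_real
          C1_on_has_derivative[OF C(2) z] C1_on_has_derivative[OF C(3) z])
    moreover have "dy (dy f) z = - dx (dx f) z" using C(4)[OF z] by simp
    moreover have "dy (dx f) z = dx (dy f) z" by (rule mixed_partials_eq[OF U z C(1-3)])
    ultimately show ?thesis unfolding has_field_derivative_def
      by (elim has_derivative_eq_rhs) (auto simp: complex_eq_iff algebra_simps)
  qed
  then show ?thesis using U by (auto simp: holomorphic_on_open)
qed

text \<open>A harmonic conjugate after pullback: \<open>G\<close> is a primitive of the complex
  gradient along \<open>g\<close> times g', whose real part is the differential of
  \<open>f (g w)\<close>. Convexity is asked of the source only, so \<open>V\<close> may be the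
  punctured disc with \<open>g\<close> = \<open>exp\<close>.\<close>

lemma harmonic_compose_eq_Re:
  fixes f :: "complex \<Rightarrow> real"
  assumes V: "open V" and f: "harmonic_on V f"
    and U: "open U" "convex U" and g: "g holomorphic_on U" "g \<in> U \<rightarrow> V"
  obtains G where "G holomorphic_on U" "\<And>w. w \<in> U \<Longrightarrow> f (g w) = Re (G w)"
proof -
  let ?k = "\<lambda>z. Complex (dx f z) (- dy f z)"
  have "(?k \<circ> g) holomorphic_on U"
    using g by (intro holomorphic_on_compose_gen[OF g(1) holomorphic_gradient[OF V f]]) auto
  then have "(\<lambda>w. ?k (g w) * deriv g w) holomorphic_on U"
    by (intro holomorphic_intros holomorphic_deriv g U) (simp add: o_def)
  then obtain G where G: "\<And>w. w \<in> U \<Longrightarrow> (G has_field_derivative ?k (g w) * deriv g w) (at w within U)"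
    using holomorphic_convex_primitive'[OF U(2,1)] by blast
  have "((\<lambda>w. f (g w) - Re (G w)) has_derivative (\<lambda>h. 0)) (at w within U)" if w: "w \<in> U" for w
  proof -
    have 1: "(f has_derivative (\<lambda>h. Re h *\<^sub>R dx f (g w) + Im h *\<^sub>R dy f (g w))) (at (g w))"
      using f g w by (intro C1_on_has_derivative[of V]) (auto simp: harmonic_on_def)
    have 2: "(g has_derivative (*) (deriv g w)) (at w)"
      using holomorphic_derivI[OF g(1) U(1) w] by (simp add: has_field_derivative_def)
    have 3: "(G has_derivative (*) (?k (g w) * deriv g w)) (at w)"
      using G[OF w] at_within_open[OF w U(1)] by (simp add: has_field_derivative_def)
    have "((\<lambda>w. f (g w) - Re (G w)) has_derivative (\<lambda>h. 0)) (at w)"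
      by (rule has_derivative_eq_rhs[OF has_derivative_diff[OF has_derivative_compose[OF 2 1] 
            bounded_linear.has_derivative[OF bounded_linear_Re 3]]]) (auto simp: algebra_simps)
    then show ?thesis using has_derivative_at_withinI by blast
  qed
  then obtain c where c: "\<And>w. w \<in> U \<Longrightarrow> f (g w) - Re (G w) = c"
    using has_derivative_zero_constant[OF U(2), of "\<lambda>w. f (g w) - Re (G w)"] by auto
  have "G holomorphic_on U"
    using G unfolding holomorphic_on_def field_differentiable_def by blast
  then have "(\<lambda>w. G w + of_real c) holomorphic_on U"
    by (intro holomorphic_intros)
  moreover have "f (g w) = Re (G w + of_real c)" if "w \<in> U" for w
    using c[OF that] by simp
  ultimately show ?thesis by (rule that)
qed

subsection \<open>Subharmonicity along conformal harmonic maps\<close>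

text \<open>Where the differential is nonzero, it is itself the required parametrization. Where it
  vanishes, it spans no plane to test on, and two small orthogonal axis vectors replace it; this is
  where two dimensions are used.\<close>

lemma conformal_linear_approx:
  fixes f :: "complex \<Rightarrow> real ^ 'n"
  assumes n: "CARD('n) \<ge> 2" and f: "conformal_on U f" and z: "z \<in> U" and k: "0 < (\<kappa>::real)"
  obtains v w r where "norm v = norm w" "v \<noteq> 0" "v \<bullet> w = 0" "0 < r"
    "\<And>\<zeta>. norm \<zeta> \<le> r \<Longrightarrow> norm (f (z + \<zeta>) - f z - (Re \<zeta> *\<^sub>R v + Im \<zeta> *\<^sub>R w)) \<le> \<kappa> * norm \<zeta>"
proof -
  let ?v = "dx f z" and ?w = "dy f z"
  have c: "norm ?v = norm ?w" "?v \<bullet> ?w = 0" using f z by (auto simp: conformal_on_def)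
  have "(f has_derivative (\<lambda>h. Re h *\<^sub>R ?v + Im h *\<^sub>R ?w)) (at z)"
    using f z C1_on_has_derivative unfolding conformal_on_def by blast
  then have "\<exists>d>0. \<forall>y. norm (y - z) < d \<longrightarrow>
      norm (f y - f z - (Re (y - z) *\<^sub>R ?v + Im (y - z) *\<^sub>R ?w)) \<le> \<kappa> / 2 * norm (y - z)"
    unfolding has_derivative_at_alt using half_gt_zero[OF k] by blast
  then obtain d where d: "d > 0" "\<And>y. norm (y - z) < d \<Longrightarrow>
      norm (f y - f z - (Re (y - z) *\<^sub>R ?v + Im (y - z) *\<^sub>R ?w)) \<le> \<kappa> / 2 * norm (y - z)"
    by blast
  have E: "norm (f (z + \<zeta>) - f z - (Re \<zeta> *\<^sub>R ?v + Im \<zeta> *\<^sub>R ?w)) \<le> \<kappa> / 2 * norm \<zeta>" if "norm \<zeta> \<le> d/2" for \<zeta>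
    using d(2)[of "z + \<zeta>"] that d(1) by simp
  show ?thesis
  proof (cases "?v = 0")
    case False
    show ?thesis
    proof (rule that[OF c(1) False c(2), of "d/2"])
      fix \<zeta> :: complex assume "norm \<zeta> \<le> d/2"
      then have "norm (f (z + \<zeta>) - f z - (Re \<zeta> *\<^sub>R ?v + Im \<zeta> *\<^sub>R ?w)) \<le> \<kappa> / 2 * norm \<zeta>" by (rule E)
      also have "\<dots> \<le> \<kappa> * norm \<zeta>" using k by (simp add: mult_right_mono)
      finally show "norm (f (z + \<zeta>) - f z - (Re \<zeta> *\<^sub>R ?v + Im \<zeta> *\<^sub>R ?w)) \<le> \<kappa> * norm \<zeta>" .
    qed (use d in auto)
  next
    case True
    obtain i j :: 'n where ij: "i \<noteq> j"
      using n card_le_Suc0_iff_eq[of "UNIV::'n set"] by fastforce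
    \<comment> \<open>Since |Re \<zeta>| + |Im \<zeta>| is at most 2 |\<zeta>|, length \<kappa>/4
      costs \<kappa>/2; the differentiability error takes the other \<kappa>/2.\<close>
    let ?v' = "(\<kappa>/4) *\<^sub>R axis i (1::real)" and ?w' = "(\<kappa>/4) *\<^sub>R axis j (1::real)"
    show ?thesis
    proof (rule that[of ?v' ?w' "d/2"])
      show "norm ?v' = norm ?w'" by simp
      show "?v' \<noteq> 0" using k by (simp add: axis_eq_0_iff)
      show "?v' \<bullet> ?w' = 0" using ij by (simp add: inner_axis_axis)
      fix \<zeta> :: complex assume "norm \<zeta> \<le> d/2"
      then have "norm (f (z + \<zeta>) - f z) \<le> \<kappa> / 2 * norm \<zeta>" using E[of \<zeta>] True c(1) by simp
      moreover have "norm (Re \<zeta> *\<^sub>R ?v' + Im \<zeta> *\<^sub>R ?w') \<le> \<bar>Re \<zeta>\<bar> * (\<kappa>/4) + \<bar>Im \<zeta>\<bar> * (\<kappa>/4)"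
        by (rule norm_triangle_le) (use k in \<open>simp add: norm_axis_1 abs_mult\<close>)
      moreover have "\<bar>Re \<zeta>\<bar> * (\<kappa>/4) + \<bar>Im \<zeta>\<bar> * (\<kappa>/4) \<le> norm \<zeta> * (\<kappa>/4) + norm \<zeta> * (\<kappa>/4)"
        by (intro add_mono mult_right_mono abs_Re_le_cmod abs_Im_le_cmod) (use k in auto)
      moreover have "norm (f (z + \<zeta>) - f z - (Re \<zeta> *\<^sub>R ?v' + Im \<zeta> *\<^sub>R ?w')) \<le>
          norm (f (z + \<zeta>) - f z) + norm (Re \<zeta> *\<^sub>R ?v' + Im \<zeta> *\<^sub>R ?w')" by (rule norm_triangle_ineq4)
      ultimately show "norm (f (z + \<zeta>) - f z - (Re \<zeta> *\<^sub>R ?v' + Im \<zeta> *\<^sub>R ?w')) \<le> \<kappa> * norm \<zeta>" by argo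
    qed (use d in auto)
  qed
qed

lemma subharmonic_onD:
  assumes "subharmonic_on U u" "compact K" "K \<subseteq> U" "continuous_on K h" "harmonic_on (interior K) h"
    and "\<And>z. z \<in> frontier K \<Longrightarrow> u z \<le> ereal (h z)" and "z \<in> K"
  shows "u z \<le> ereal (h z)"
  using assms unfolding subharmonic_on_def by blast

text \<open>Cutting off at a real level removes the value -\<infinity> and gives a real continuous
  function, which is bounded and uniformly continuous on compact sets.\<close>

lemma truncate_ereal:
  fixes u :: "'a::t2_space \<Rightarrow> ereal" and c :: real
  assumes "continuous_on S u" "\<And>x. x \<in> S \<Longrightarrow> u x < \<infinity>"
  obtains v :: "'a \<Rightarrow> real" where "continuous_on S v" "\<And>x. x \<in> S \<Longrightarrow> ereal (v x) = max (u x) (ereal c)"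
proof -
  define m where "m x = max (u x) (ereal c)" for x
  have fin: "\<bar>m x\<bar> \<noteq> \<infinity>" if "x \<in> S" for x
    using assms(2)[OF that] by (cases "u x") (auto simp: m_def max_def)
  have "continuous_on S m" unfolding m_def by (intro continuous_on_max assms(1) continuous_on_const)
  then have "continuous_on S (real_of_ereal \<circ> m)" using continuous_on_iff_real[of S m] fin by blast
  moreover have "ereal ((real_of_ereal \<circ> m) x) = max (u x) (ereal c)" if "x \<in> S" for x
    using fin[OF that] by (simp add: ereal_real m_def)
  ultimately show ?thesis using that by blast
qed

text \<open>No smoothing of \<open>u\<close> is needed: a point of \<open>K\<close> violating the majorization survives in a maximum
  of \<open>v x - h z + c|z|\<^sup>2 - N|x - f z|\<^sup>2\<close> over pairs \<open>(z, x)\<close> with \<open>x\<close> near \<open>f z\<close>. There \<open>x\<close> is moved along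
  an affine plane nearly tangent to \<open>f\<close> while \<open>z\<close> moves along: the vector \<open>x - f z\<close> then changes by a
  harmonic function that is \<open>o(r)\<close> on the circle of radius \<open>r\<close>, so the penalty contributes a harmonic
  term and an error \<open>o(r\<^sup>2)\<close>, which the term \<open>c|z|\<^sup>2\<close> absorbs.\<close>

lemma MPSH_compose_subharmonic:
  fixes f :: "complex \<Rightarrow> real ^ 'n"
  assumes n: "CARD('n) \<ge> 2" and \<Omega>: "open \<Omega>" and u: "continuous_on \<Omega> u" "MPSH_on \<Omega> u"
    and U: "open U" and f: "conformal_harmonic_map U \<Omega> f"
  shows "subharmonic_on U (u \<circ> f)"
  unfolding subharmonic_on_def
proof (intro conjI allI impI ballI)
  have fU: "f ` U \<subseteq> \<Omega>" and conf: "conformal_on U f" and harm: "harmonic_on U f"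
    using f by (auto simp: conformal_harmonic_map_def)
  have fc: "continuous_on U f" by (rule harmonic_on_imp_continuous_on[OF harm])
  have ufin: "u x < \<infinity>" if "x \<in> \<Omega>" for x
    using u(2) that by (auto simp: MPSH_on_def usc_on_def)
  have ufc: "continuous_on U (u \<circ> f)"
    by (rule continuous_on_compose[OF fc continuous_on_subset[OF u(1) fU]])
  have "openin (top_of_set U) {z \<in> U. (u \<circ> f) z < c}" for c
    using continuous_openin_preimage_gen[OF ufc open_lessThan[of c]] by (simp add: vimage_def Int_def)
  then show "usc_on U (u \<circ> f)" unfolding usc_on_def using fU ufin by auto

  fix K and h :: "complex \<Rightarrow> real" and z1
  assume K: "compact K" "K \<subseteq> U" and hc: "continuous_on K h" and hh: "harmonic_on (interior K) h"
    and fr: "\<forall>z\<in>frontier K. (u \<circ> f) z \<le> ereal (h z)" and z1: "z1 \<in> K"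
  show "(u \<circ> f) z1 \<le> ereal (h z1)"
  proof (rule ccontr)
    assume "\<not> (u \<circ> f) z1 \<le> ereal (h z1)"
    then obtain s where s: "h z1 < s" "ereal s < u (f z1)"
      using ereal_dense2[of "ereal (h z1)" "u (f z1)"] by (auto simp: not_le)
    define \<eta> where "\<eta> = s - h z1"
    have \<eta>: "\<eta> > 0" using s by (simp add: \<eta>_def)
    obtain R where R: "R \<ge> 1" "\<And>z. z \<in> K \<Longrightarrow> norm z \<le> R"
      using compact_imp_bounded[OF K(1)] unfolding bounded_iff
      by (metis linorder_linear order_trans)
    \<comment> \<open>Then c |z|^2 is at most \<eta>/4 on \<open>K\<close> and leaves most of the
      excess \<eta> intact.\<close>
    define c where "c = \<eta> / (4 * R\<^sup>2)"
    have c: "c > 0" using \<eta> R by (simp add: c_def)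
    have cR: "c * (norm z)\<^sup>2 \<le> \<eta> / 4" if "z \<in> K" for z
    proof -
      have "c * (norm z)\<^sup>2 \<le> c * R\<^sup>2" using c R(2)[OF that] by (intro mult_left_mono power_mono) auto
      then show ?thesis using R by (simp add: c_def)
    qed
    obtain H0 where H0: "\<And>z. z \<in> K \<Longrightarrow> \<bar>h z\<bar> \<le> H0"
      using compact_imp_bounded[OF compact_continuous_image[OF hc K(1)]] unfolding bounded_iff by auto
    have fK: "compact (f ` K)" "f ` K \<subseteq> \<Omega>" using K fU
      by (auto intro: compact_continuous_image continuous_on_subset[OF fc])
    obtain d where d: "d > 0" "(\<Union>x\<in>f ` K. cball x d) \<subseteq> \<Omega>"
      using compact_subset_open_imp_cball_epsilon_subset[OF fK(1) \<Omega> fK(2)] by auto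
    \<comment> \<open>The range of the second variable: a neighbourhood of the image of
      \<open>K\<close> inside \<Omega>, compact as a sum of two compact sets.\<close>
    define B where "B = (\<Union>x\<in>f ` K. cball x d)"
    have "B = {x + y |x y. x \<in> f ` K \<and> y \<in> cball 0 d}"
    proof (rule set_eqI)
      have "y \<in> cball x d \<longleftrightarrow> (\<exists>e\<in>cball 0 d. y = x + e)" for x y :: "real ^ 'n"
        by (rule iffI, rule bexI[of _ "y - x"]) (auto simp: dist_norm norm_minus_commute)
      then show "y \<in> B \<longleftrightarrow> y \<in> {x + y |x y. x \<in> f ` K \<and> y \<in> cball 0 d}" for y
        unfolding B_def by blast
    qed
    moreover have "compact {x + y |x y. x \<in> f ` K \<and> y \<in> cball 0 d}"
      by (rule compact_sums[OF fK(1) compact_cball])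
    ultimately have B: "compact B" "B \<subseteq> \<Omega>" using d(2) by (simp_all only: flip: B_def)
    \<comment> \<open>Below all values of \<open>h\<close> on \<open>K\<close>, so truncation
      preserves the majorization on the frontier. At the maximizing pair \<open>v\<close> exceeds
      \<open>m\<close> and therefore equals \<open>u\<close>.\<close>
    define m where "m = - (H0 + \<eta> / 4)"
    obtain v where vc: "continuous_on \<Omega> v" and v: "\<And>x. x \<in> \<Omega> \<Longrightarrow> ereal (v x) = max (u x) (ereal m)"
      using truncate_ereal[OF u(1) ufin, where c = m] by blast
    have vu: "u x \<le> ereal (v x)" if "x \<in> \<Omega>" for x using v[OF that] by simp
    have vB: "continuous_on B v" by (rule continuous_on_subset[OF vc B(2)])
    obtain V0 where V0: "\<And>x. x \<in> B \<Longrightarrow> \<bar>v x\<bar> \<le> V0"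
      using compact_imp_bounded[OF compact_continuous_image[OF vB B(1)]] unfolding bounded_iff by auto
    have "uniformly_continuous_on B v" by (rule compact_uniformly_continuous[OF vB B(1)])
    moreover have "\<eta> / 4 > 0" using \<eta> by simp
    ultimately have "\<exists>d>0. \<forall>x\<in>B. \<forall>y\<in>B. dist y x < d \<longrightarrow> dist (v y) (v x) < \<eta> / 4"
      unfolding uniformly_continuous_on_def by fast
    then obtain d1 where d1: "d1 > 0" "\<And>x y. x \<in> B \<Longrightarrow> y \<in> B \<Longrightarrow> dist y x < d1 \<Longrightarrow> dist (v y) (v x) < \<eta>/4"
      by fast
    \<comment> \<open>Within \<open>d2\<close> of \<open>f z0\<close>, \<open>v\<close> changes by
      less than \<eta>/4, and half of the radius \<open>d\<close> remains for moving
      \<open>x0\<close> along the plane without leaving \<open>B\<close>.\<close>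
    define d2 where "d2 = min d1 (d/2)"
    have d2: "d2 > 0" using d d1 by (simp add: d2_def)
    \<comment> \<open>\<open>M\<close> exceeds anything the other terms of \<Phi> can contribute,
      and N d2^2 = M, so the penalty forces a maximizing pair to satisfy |x - f z| < d2.\<close>
    define M where "M = \<bar>V0\<bar> + \<bar>H0\<bar> + \<eta> / 4 + 1"
    have M: "M > 0" using \<eta> by (simp add: M_def)
    define N where "N = M / d2\<^sup>2"
    have N: "N > 0" "N * d2\<^sup>2 = M" using M d2 by (auto simp: N_def)
    define \<Phi> where "\<Phi> = (\<lambda>(z, x). v x - h z + c * (norm z)\<^sup>2 - N * (norm (x - f z))\<^sup>2)"
    have "continuous_on (K \<times> B) \<Phi>"
      unfolding \<Phi>_def case_prod_unfold
      by (intro continuous_intros continuous_on_compose2[OF vB] continuous_on_compose2[OF hc]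
          continuous_on_compose2[OF fc]) (use K in auto)
    moreover have z1B: "(z1, f z1) \<in> K \<times> B" using z1 d by (force simp: B_def)
    ultimately have "\<exists>p\<in>K \<times> B. \<forall>q\<in>K \<times> B. \<Phi> q \<le> \<Phi> p"
      by (intro continuous_attains_sup compact_Times K B) auto
    then obtain z0 x0 where zx: "z0 \<in> K" "x0 \<in> B" and max: "\<And>z x. z \<in> K \<Longrightarrow> x \<in> B \<Longrightarrow> \<Phi> (z, x) \<le> \<Phi> (z0, x0)"
      by fastforce
    have "s \<le> v (f z1)" using v[of "f z1"] s fU K z1
      by (metis ereal_less_eq(3) image_subset_iff less_imp_le max.coboundedI1 subsetD)
    \<comment> \<open>The penalty vanishes at the pair formed by \<open>z1\<close> and its image, so
      the violation at \<open>z1\<close> bounds the maximum from below.\<close>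
    then have "\<eta> \<le> \<Phi> (z1, f z1)" using c by (simp add: \<Phi>_def \<eta>_def add_increasing2)
    also have "\<dots> \<le> \<Phi> (z0, x0)" using z1B max by auto
    finally have big: "\<eta> \<le> v x0 - h z0 + c * (norm z0)\<^sup>2 - N * (norm (x0 - f z0))\<^sup>2" by (simp add: \<Phi>_def)
    have pen: "N * (norm (x0 - f z0))\<^sup>2 \<ge> 0" using N by simp
    have "N * (norm (x0 - f z0))\<^sup>2 < N * d2\<^sup>2"
      unfolding N(2) M_def using big V0[OF zx(2)] H0[OF zx(1)] cR[OF zx(1)] \<eta> by linarith
    then have "(norm (x0 - f z0))\<^sup>2 < d2\<^sup>2" using N(1) by simp
    then have near: "norm (x0 - f z0) < d2" by (rule power2_less_imp_less) (use d2 in simp)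
    have fz0B: "f z0 \<in> B" using zx d by (force simp: B_def)
    have "dist (v x0) (v (f z0)) < \<eta>/4"
      using near by (intro d1(2) fz0B zx) (simp add: dist_norm d2_def)
    then have w0: "\<eta> / 2 < v (f z0) - h z0"
      using big pen cR[OF zx(1)] by (simp add: dist_real_def abs_if split: if_splits)
    \<comment> \<open>On the frontier of \<open>K\<close>, \<open>v (f z0)\<close> would be at most
      \<open>h z0\<close>, against the remaining margin \<eta>/2.\<close>
    have z0I: "z0 \<in> interior K"
    proof (rule ccontr)
      assume "z0 \<notin> interior K"
      then have "z0 \<in> frontier K" using zx(1) closure_subset by (auto simp: frontier_def)
      then have "u (f z0) \<le> ereal (h z0)" using fr by simp
      moreover have "m \<le> h z0" using H0[OF zx(1)] \<eta> by (simp add: m_def)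
      moreover have "f z0 \<in> \<Omega>" using fz0B B by blast
      ultimately have "ereal (v (f z0)) \<le> ereal (h z0)" by (simp only: v) simp
      then show False using w0 \<eta> by simp
    qed
    have x0\<Omega>: "x0 \<in> \<Omega>" using zx B by auto
    have "v x0 > m" using big pen cR[OF zx(1)] H0[OF zx(1)] \<eta> by (simp add: m_def)
    then have ux0: "u x0 = ereal (v x0)" using v[OF x0\<Omega>] by (auto simp: max_def split: if_splits)

    define a where "a = x0 - f z0"
    \<comment> \<open>With this slope the quadratic error of the penalty is at most c r^2 / 2, half
      of the gain c r^2 from the term c |z|^2.\<close>
    define \<kappa> where "\<kappa> = sqrt (c / (2 * N))"
    have \<kappa>: "\<kappa> > 0" "N * \<kappa>\<^sup>2 = c / 2" using c N by (auto simp: \<kappa>_def)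
    obtain p q r0 where pq: "norm p = norm q" "p \<noteq> 0" "p \<bullet> q = 0" and r0: "0 < r0"
      "\<And>\<zeta>. norm \<zeta> \<le> r0 \<Longrightarrow> norm (f (z0 + \<zeta>) - f z0 - (Re \<zeta> *\<^sub>R p + Im \<zeta> *\<^sub>R q)) \<le> \<kappa> * norm \<zeta>"
      using conformal_linear_approx[OF n conf _ \<kappa>(1), of z0] zx K by blast
    obtain r1 where r1: "r1 > 0" "cball z0 r1 \<subseteq> interior K"
      using z0I open_interior open_contains_cball by blast
    \<comment> \<open>The bound d / (4 |p|) makes the displacement \<open>L \<zeta>\<close> at most
      d/2.\<close>
    define r where "r = min (min r0 r1) (d / (4 * norm p))"
    have r: "r > 0" "r \<le> r0" "r \<le> r1" "r \<le> d / (4 * norm p)"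
      using r0(1) r1(1) d(1) pq(2) by (simp_all add: r_def)
    then have rp: "r * norm p \<le> d / 4" using pq(2) by (simp add: field_simps)
    define L where "L = (\<lambda>\<zeta>. Re \<zeta> *\<^sub>R p + Im \<zeta> *\<^sub>R q)"
    define E where "E = (\<lambda>\<zeta>. f (z0 + \<zeta>) - f z0 - L \<zeta>)"
    have inK: "z0 + \<zeta> \<in> interior K" if "norm \<zeta> \<le> r" for \<zeta>
      using r1 r that by (auto simp: subset_iff dist_norm)
    have inB: "x0 + L \<zeta> \<in> B" if "norm \<zeta> \<le> r" for \<zeta>
    proof -
      have "norm (L \<zeta>) \<le> \<bar>Re \<zeta>\<bar> * norm p + \<bar>Im \<zeta>\<bar> * norm p"
        unfolding L_def by (rule norm_triangle_le) (simp add: pq(1))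
      also have "\<dots> \<le> r * norm p + r * norm p"
        by (intro add_mono mult_right_mono order_trans[OF abs_Re_le_cmod that] order_trans[OF abs_Im_le_cmod that]) auto
      finally have "norm (L \<zeta>) \<le> d / 2" using rp by simp
      moreover have "norm (x0 - f z0) \<le> d / 2" using near by (simp add: d2_def)
      ultimately have "norm ((x0 - f z0) + L \<zeta>) \<le> d" by (intro norm_triangle_le) simp
      then have "x0 + L \<zeta> \<in> cball (f z0) d" by (simp add: dist_norm norm_minus_commute algebra_simps)
      then show ?thesis using zx by (auto simp: B_def)
    qed
    \<comment> \<open>Maximality of \<Phi> solved for \<open>v (x0 + L \<zeta>)\<close>: the terms
      linear in the displacement, together with \<open>h\<close> and \<open>f\<close>, are harmonic
      in \<zeta>, and on the circle the quadratic ones are bounded by a constant. At the centre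
      \<open>H\<close> falls short of \<open>v x0\<close> by c r^2 / 2, which is the
      contradiction.\<close>
    define H where "H = (\<lambda>\<zeta>. h (z0 + \<zeta>) + ((2 * N) *\<^sub>R a \<bullet> L \<zeta> - (2 * c) *\<^sub>R z0 \<bullet> \<zeta>) - (2 * N) *\<^sub>R a \<bullet> f (z0 + \<zeta>)
        + (v x0 - h z0 + (2 * N) *\<^sub>R a \<bullet> f z0 - c / 2 * r\<^sup>2))"
    have uH: "u (x0 + L \<zeta>) \<le> ereal (H \<zeta>)" if \<zeta>: "norm \<zeta> = r" for \<zeta>
    proof -
      have "\<Phi> (z0 + \<zeta>, x0 + L \<zeta>) \<le> \<Phi> (z0, x0)"
        using inK[of \<zeta>] inB[of \<zeta>] \<zeta> interior_subset by (intro max) auto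
      moreover have "x0 + L \<zeta> - f (z0 + \<zeta>) = a - E \<zeta>" by (simp add: a_def E_def)
      ultimately have "v (x0 + L \<zeta>) - h (z0 + \<zeta>) + c * (norm (z0 + \<zeta>))\<^sup>2 - N * (norm (a - E \<zeta>))\<^sup>2 \<le>
          v x0 - h z0 + c * (norm z0)\<^sup>2 - N * (norm a)\<^sup>2" by (simp add: \<Phi>_def a_def)
      moreover have "(norm (z0 + \<zeta>))\<^sup>2 = (norm z0)\<^sup>2 + 2 * (z0 \<bullet> \<zeta>) + r\<^sup>2"
        unfolding \<zeta>[symmetric] power2_norm_eq_inner by (simp add: inner_commute algebra_simps)
      then have "c * (norm (z0 + \<zeta>))\<^sup>2 = c * (norm z0)\<^sup>2 + c * (2 * (z0 \<bullet> \<zeta>)) + c * r\<^sup>2"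
        by (simp only: distrib_left)
      moreover have "(norm (a - E \<zeta>))\<^sup>2 = (norm a)\<^sup>2 - 2 * (a \<bullet> E \<zeta>) + (norm (E \<zeta>))\<^sup>2"
        unfolding power2_norm_eq_inner by (simp add: inner_commute algebra_simps)
      then have "N * (norm (a - E \<zeta>))\<^sup>2 = N * (norm a)\<^sup>2 - N * (2 * (a \<bullet> E \<zeta>)) + N * (norm (E \<zeta>))\<^sup>2"
        by (simp only: distrib_left right_diff_distrib)
      moreover have "N * (norm (E \<zeta>))\<^sup>2 \<le> N * (\<kappa> * r)\<^sup>2"
        using r0(2)[of \<zeta>] r \<zeta> N by (intro mult_left_mono power_mono) (auto simp: E_def L_def)
      moreover have "N * (\<kappa> * r)\<^sup>2 = c * r\<^sup>2 / 2"
        using arg_cong[OF \<kappa>(2), of "\<lambda>x. x * r\<^sup>2"] by (simp add: power_mult_distrib)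
      ultimately have "v (x0 + L \<zeta>) \<le> v x0 + h (z0 + \<zeta>) - h z0 - (c * (2 * (z0 \<bullet> \<zeta>)) + c * r\<^sup>2) -
          N * (2 * (a \<bullet> E \<zeta>)) + c * r\<^sup>2 / 2" by linarith
      also have "\<dots> = H \<zeta>" by (simp add: H_def E_def algebra_simps)
      finally show ?thesis using vu[of "x0 + L \<zeta>"] inB[of \<zeta>] B \<zeta>
        by (meson ereal_less_eq(3) order_refl order_trans subsetD)
    qed
    have hH: "harmonic_on S H" if S: "open S" "\<And>\<zeta>. \<zeta> \<in> S \<Longrightarrow> z0 + \<zeta> \<in> interior K" for S
    proof -
      have "bounded_linear (\<lambda>\<zeta>. (2 * N) *\<^sub>R a \<bullet> L \<zeta> - (2 * c) *\<^sub>R z0 \<bullet> \<zeta>)"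
        unfolding L_def
        by (intro bounded_linear_sub bounded_linear_inner_right bounded_linear_add
            bounded_linear_compose[OF bounded_linear_inner_right]
            bounded_linear_compose[OF bounded_linear_scaleR_left] bounded_linear_Re bounded_linear_Im)
      then have 1: "harmonic_on S (\<lambda>\<zeta>. (2 * N) *\<^sub>R a \<bullet> L \<zeta> - (2 * c) *\<^sub>R z0 \<bullet> \<zeta>)"
        using harmonic_on_bounded_linear[OF holomorphic_imp_harmonic_on[OF holomorphic_on_ident S(1)] S(1)] by blast
      have "harmonic_on (interior K) f"
        using harmonic_on_subset[OF harm] K interior_subset by blast
      then have "harmonic_on (interior K) (\<lambda>z. (2 * N) *\<^sub>R a \<bullet> f z)"
        by (rule harmonic_on_bounded_linear[OF _ open_interior bounded_linear_inner_right])
      from harmonic_on_affine[OF this, of z0 1] harmonic_on_affine[OF hh, of z0 1]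
      have "harmonic_on S (\<lambda>\<zeta>. (2 * N) *\<^sub>R a \<bullet> f (z0 + \<zeta>))" "harmonic_on S (\<lambda>\<zeta>. h (z0 + \<zeta>))"
        using S by (auto elim!: harmonic_on_subset)
      then show ?thesis unfolding H_def
        by (intro harmonic_on_add[OF harmonic_on_diff[OF harmonic_on_add[OF _ 1]]] harmonic_on_const S)
    qed
    \<comment> \<open>Continuity up to the circle comes from harmonicity on the larger open set of
      all \<zeta> with \<open>z0 + \<zeta>\<close> in the interior of \<open>K\<close>.\<close>
    have cH: "continuous_on (cball 0 r) H"
    proof (rule continuous_on_subset[OF harmonic_on_imp_continuous_on[OF hH]])
      show "open ((\<lambda>\<zeta>. z0 + \<zeta>) -` interior K)" by (intro open_vimage continuous_intros) auto
    qed (use inK in auto)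
    have pc: "plane_coord x0 p q = (\<lambda>\<zeta>. x0 + L \<zeta>)" by (simp add: fun_eq_iff plane_coord_def L_def)
    have "subharmonic_on (plane_coord x0 p q -` \<Omega>) (u \<circ> plane_coord x0 p q)"
      using u(2) pq by (simp add: MPSH_on_def)
    then have "(u \<circ> plane_coord x0 p q) 0 \<le> ereal (H 0)"
    proof (rule subharmonic_onD[where K = "cball 0 r"])
      show "cball 0 r \<subseteq> plane_coord x0 p q -` \<Omega>"
        using subsetD[OF B(2) inB] by (simp add: subset_iff pc)
      show "harmonic_on (interior (cball 0 r)) H" using inK by (intro hH) (auto simp: interior_cball)
      show "(u \<circ> plane_coord x0 p q) \<zeta> \<le> ereal (H \<zeta>)" if "\<zeta> \<in> frontier (cball 0 r)" for \<zeta>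
        using uH[of \<zeta>] that by (simp add: pc)
    qed (use cH r in auto)
    then have "u (x0 + L 0) \<le> ereal (H 0)" by (simp add: pc)
    then have "v x0 \<le> v x0 - c / 2 * r\<^sup>2" by (simp add: L_def H_def ux0)
    then show False using c r by (simp add: mult_le_0_iff)
  qed
qed

subsection \<open>Removable singularities\<close>

lemma harmonic_on_local:
  assumes "\<And>z. z \<in> U \<Longrightarrow> \<exists>V. open V \<and> z \<in> V \<and> harmonic_on V f"
  shows "harmonic_on U f"
proof -
  have loc: "C1_on U g" if g: "\<And>z. z \<in> U \<Longrightarrow> \<exists>V. open V \<and> z \<in> V \<and> C1_on V g" for g :: "complex \<Rightarrow> 'a"
    unfolding C1_on_def
  proof (intro conjI ballI continuous_at_imp_continuous_on)
    fix z assume "z \<in> U"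
    then obtain V where "open V" "z \<in> V" "C1_on V g" using g by blast
    then show "g differentiable at z" "isCont (dx g) z" "isCont (dy g) z"
      by (auto simp: C1_on_def continuous_on_eq_continuous_at)
  qed
  show ?thesis
    unfolding harmonic_on_def
    by (intro conjI loc ballI) (use assms in \<open>unfold harmonic_on_def, blast+\<close>)
qed

text \<open>Division by \<open>z0\<close> moves the disc to the unit disc about 1, away from the cut
  of \<open>Ln\<close>; thus every nonzero point has a disc with its own branch of the
  logarithm.\<close>

lemma Re_pos_divide_ball:
  assumes "z \<in> ball z0 (norm z0)"
  shows "Re (z / z0) > 0"
proof -
  have z0: "z0 \<noteq> 0" using assms by auto
  have "norm (1 - z / z0) = norm (z0 - z) / norm z0" using z0 by (simp add: norm_divide[symmetric] diff_divide_distrib)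
  also have "\<dots> < 1" using assms z0 by (simp add: dist_norm)
  finally show ?thesis using complex_Re_le_cmod[of "1 - z / z0"] by simp
qed

lemma holomorphic_on_Ln_divide: "(\<lambda>z. Ln (z / z0)) holomorphic_on ball z0 (norm z0)"
proof (intro holomorphic_intros)
  fix z assume z: "z \<in> ball z0 (norm z0)"
  then show "z / z0 \<notin> \<real>\<^sub>\<le>\<^sub>0" using Re_pos_divide_ball[OF z] by (auto simp: complex_nonpos_Reals_iff)
qed auto

lemma harmonic_on_ln_norm: "harmonic_on (- {0}) (\<lambda>z. ln (norm z))"
proof (rule harmonic_on_local)
  fix z0 :: complex assume "z0 \<in> - {0}"
  then have z0: "z0 \<noteq> 0" by simp
  have "harmonic_on (ball z0 (norm z0)) (\<lambda>z. Re (Ln (z / z0)) + ln (norm z0))"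
    by (intro harmonic_on_add holomorphic_imp_harmonic_on_Re holomorphic_on_Ln_divide harmonic_on_const) auto
  then have "harmonic_on (ball z0 (norm z0)) (\<lambda>z. ln (norm z))"
  proof (rule harmonic_on_cong)
    fix z assume "z \<in> ball z0 (norm z0)"
    then have "z \<noteq> 0" using Re_pos_divide_ball[of z z0] by auto
    then show "Re (Ln (z / z0)) + ln (norm z0) = ln (norm z)"
      using z0 by (simp add: norm_divide ln_div)
  qed auto
  then show "\<exists>V. open V \<and> z0 \<in> V \<and> harmonic_on V (\<lambda>z. ln (norm z))"
    using z0 by (intro exI[of _ "ball z0 (norm z0)"]) auto
qed

lemma holomorphic_Re_zero_imp_const:
  assumes U: "open U" "convex U" and g: "g holomorphic_on U" and Re: "\<And>w. w \<in> U \<Longrightarrow> Re (g w) = 0"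
  obtains c where "\<And>w. w \<in> U \<Longrightarrow> g w = c"
proof -
  have "(g has_field_derivative 0) (at w within U)" if w: "w \<in> U" for w
  proof -
    have d: "(g has_field_derivative deriv g w) (at w)" by (rule holomorphic_derivI[OF g U(1) w])
    then have "((\<lambda>w. Re (g w)) has_derivative (\<lambda>h. Re (deriv g w * h))) (at w)"
      by (intro bounded_linear.has_derivative[OF bounded_linear_Re]) (simp add: has_field_derivative_def)
    then have "((\<lambda>w. 0) has_derivative (\<lambda>h. Re (deriv g w * h))) (at w)"
      by (rule has_derivative_transform_open[OF _ U(1) w Re])
    then have "(\<lambda>h. Re (deriv g w * h)) = (\<lambda>h. 0)"
      by (rule has_derivative_unique) (rule has_derivative_const)
    \<comment> \<open>Testing the vanishing differential on the conjugate of g' produces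
      |g'|^2.\<close>
    then have "Re (deriv g w * cnj (deriv g w)) = 0" by meson
    then have "deriv g w = 0" by (simp add: complex_mult_cnj complex_eq_iff sum_power2_eq_zero_iff)
    then show ?thesis using d has_field_derivative_at_within by metis
  qed
  then show ?thesis using has_field_derivative_zero_constant[OF U(2), of g] that by auto
qed

text \<open>Pulled back by \<open>exp\<close>, \<open>f\<close> is the real part of a holomorphic \<open>G\<close> on a half plane. The period
  \<open>G (w + 2\<pi>\<i>) - G w\<close> is imaginary, so for a suitable real \<open>k \<noteq> 0\<close> the function \<open>exp (k G)\<close> descends to the
  punctured disc. It is bounded and bounded away from zero near \<open>0\<close>, so it extends without zeros.\<close>

lemma harmonic_removable_singularity:
  fixes f :: "complex \<Rightarrow> real"
  assumes f: "harmonic_on (ball 0 1 - {0}) f" and \<delta>: "0 < \<delta>" "\<delta> \<le> 1"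
    and bd: "\<And>z. z \<in> ball 0 \<delta> - {0} \<Longrightarrow> \<bar>f z\<bar> \<le> B"
  obtains F where "harmonic_on (ball 0 1) F" "\<And>z. z \<in> ball 0 1 - {0} \<Longrightarrow> F z = f z"
proof -
  let ?D = "ball 0 1 - {0::complex}"
  define L where "L = {w. Re w < 0}"
  have L: "open L" "convex L" by (auto simp: L_def open_halfspace_Re_lt convex_halfspace_Re_lt)
  have D: "open ?D" by auto
  obtain G where G: "G holomorphic_on L" and fG: "\<And>w. w \<in> L \<Longrightarrow> f (exp w) = Re (G w)"
    by (rule harmonic_compose_eq_Re[OF D f L, of exp])
      (auto simp: L_def holomorphic_on_exp)
  have shift: "w + 2 * of_real pi * \<i> \<in> L" if "w \<in> L" for w using that by (simp add: L_def)
  have exp_shift: "exp (w + 2 * of_real pi * \<i>) = exp w" for w by (simp add: exp_add exp_two_pi_i)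
  have "(\<lambda>w. G (w + 2 * of_real pi * \<i>) - G w) holomorphic_on L"
    by (intro holomorphic_intros G holomorphic_on_compose_gen[OF _ G, unfolded o_def]) (use shift in auto)
  then obtain c where c: "\<And>w. w \<in> L \<Longrightarrow> G (w + 2 * of_real pi * \<i>) - G w = c"
  proof (rule holomorphic_Re_zero_imp_const[OF L])
    show "Re (G (w + 2 * of_real pi * \<i>) - G w) = 0" if "w \<in> L" for w
      using fG[OF that] fG[OF shift[OF that]] by (simp add: exp_shift)
  qed blast
  have "-1 \<in> L" by (simp add: L_def)
  then have Rec: "Re c = 0" using c[of "-1"] fG[of "-1"] fG[OF shift[of "-1"]] exp_shift[of "-1"] by auto
  \<comment> \<open>The period \<open>c\<close> is imaginary; this factor makes \<open>k * c\<close>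
    equal to 0 or 2\<pi>i, so \<open>P\<close> has period 2\<pi>i.\<close>
  define k where "k = (if Im c = 0 then 1 else 2 * pi / Im c)"
  have k: "k \<noteq> 0" by (simp add: k_def)
  define P where "P w = exp (of_real k * G w)" for w
  have holP: "P holomorphic_on L" unfolding P_def by (intro holomorphic_intros G)
  have per1: "P (w + 2 * of_real pi * \<i>) = P w" if "w \<in> L" for w
  proof -
    have "of_real k * c = (if Im c = 0 then 0 else 2 * of_real pi * \<i>)"
      using Rec by (simp add: complex_eq_iff k_def)
    then have "exp (of_real k * c) = 1" by (auto simp: exp_two_pi_i)
    moreover have "G (w + 2 * of_real pi * \<i>) = G w + c" using c[OF that] by (simp add: algebra_simps)
    ultimately show ?thesis by (simp add: P_def exp_add distrib_left)
  qed
  \<comment> \<open>Natural multiples suffice: if two logarithms differ by a negative multiple,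
    their roles are exchanged.\<close>
  have pern: "P (w + of_nat n * (2 * of_real pi * \<i>)) = P w" if "w \<in> L" for w and n :: nat
  proof (induction n)
    case (Suc n)
    have "w + of_nat n * (2 * of_real pi * \<i>) \<in> L" using that by (simp add: L_def)
    from per1[OF this] Suc show ?case by (simp add: algebra_simps)
  qed simp
  have per: "P w = P w'" if w: "w \<in> L" "w' \<in> L" "exp w = exp w'" for w w'
  proof -
    obtain n :: int where n: "w = w' + (of_int (2 * n) * pi) * \<i>" using w(3) exp_eq by blast
    show ?thesis
    proof (cases "n \<ge> 0")
      case True
      then have "w = w' + of_nat (nat n) * (2 * of_real pi * \<i>)" using n by (simp add: algebra_simps)
      then show ?thesis using pern[OF w(2), of "nat n"] by simp
    next
      case False
      then have "w' = w + of_nat (nat (- n)) * (2 * of_real pi * \<i>)" using n by (simp add: algebra_simps)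
      then show ?thesis using pern[OF w(1), of "nat (-n)"] by simp
    qed
  qed
  have LnL: "Ln z \<in> L" if "z \<in> ?D" for z using that by (simp add: L_def)
  define E where "E z = P (Ln z)" for z
  have normE: "norm (E z) = exp (k * f z)" if "z \<in> ?D" for z
    using fG[OF LnL[OF that]] that by (simp add: E_def P_def norm_exp_eq_Re)
  have "E holomorphic_on ?D"
    unfolding holomorphic_on_open[OF D] 
  proof (rule ballI)
    fix z0 assume z0: "z0 \<in> ?D"
    \<comment> \<open>\<open>Ln\<close> is discontinuous on its cut, so a local branch centred at
      \<open>z0\<close> replaces it; periodicity of \<open>P\<close> makes the choice of branch
      immaterial.\<close>
    let ?V = "ball z0 (norm z0) \<inter> ?D"
    have in_L: "Ln z0 + Ln (z / z0) \<in> L" if "z \<in> ?V" for z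
      using that z0 by (simp add: L_def norm_divide ln_div)
    have "(\<lambda>z. Ln z0 + Ln (z / z0)) holomorphic_on ?V"
      by (intro holomorphic_on_add holomorphic_on_const holomorphic_on_subset[OF holomorphic_on_Ln_divide]) auto
    then have "(\<lambda>z. P (Ln z0 + Ln (z / z0))) holomorphic_on ?V"
      by (rule holomorphic_on_compose_gen[OF _ holP, unfolded o_def]) (use in_L in blast)
    moreover have "P (Ln z0 + Ln (z / z0)) = E z" if "z \<in> ?V" for z
      unfolding E_def by (rule per[OF in_L[OF that] LnL]) (use that z0 in \<open>auto simp: exp_add\<close>)
    ultimately have "E holomorphic_on ?V" by (rule holomorphic_transform)
    moreover have "z0 \<in> ?V" using z0 by auto
    ultimately show "\<exists>f'. (E has_field_derivative f') (at z0)"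
      using holomorphic_derivI[of E ?V z0] by blast
  qed
  moreover have "eventually (\<lambda>z. z \<in> ball 0 \<delta> - {0}) (at (0::complex))"
    using \<delta> eventually_at_ball'[of \<delta> "0::complex" UNIV] by (auto elim: eventually_mono)
  \<comment> \<open>The upper bound gives the extension, the lower one its nonvanishing at 0. Using
    |k| covers both signs of \<open>k\<close>.\<close>
  then have ev: "eventually (\<lambda>z. exp (- \<bar>k\<bar> * B) \<le> norm (E z) \<and> norm (E z) \<le> exp (\<bar>k\<bar> * B)) (at 0)"
  proof eventually_elim
    case (elim z)
    have "\<bar>k * f z\<bar> \<le> \<bar>k\<bar> * B" using bd[OF elim] by (simp add: abs_mult mult_left_mono)
    moreover have "norm (E z) = exp (k * f z)" using elim \<delta> by (intro normE) auto
    ultimately show ?case by (simp add: abs_le_iff)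
  qed
  then have "\<exists>B. eventually (\<lambda>z. norm (E z) \<le> B) (at 0)" by (auto elim: eventually_mono)
  ultimately obtain E' where E': "E' holomorphic_on ball 0 1" "\<And>z. z \<in> ?D \<Longrightarrow> E' z = E z"
    using holomorphic_on_extend_bounded[of E "ball 0 1" 0] by auto
  have evD: "eventually (\<lambda>z. z \<in> ?D) (at (0::complex))"
    using eventually_at_ball'[of 1 "0::complex" UNIV] by (auto elim: eventually_mono)
  have nz: "E' z \<noteq> 0" if "z \<in> ball 0 1" for z
  proof (cases "z = 0")
    case True
    have "isCont E' 0"
      using holomorphic_on_imp_continuous_on[OF E'(1)] by (simp add: continuous_on_eq_continuous_at)
    then have "((\<lambda>z. norm (E' z)) \<longlongrightarrow> norm (E' 0)) (at 0)" by (intro tendsto_norm) (simp add: isCont_def)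
    moreover have "eventually (\<lambda>z. exp (- \<bar>k\<bar> * B) \<le> norm (E' z)) (at 0)"
      using ev evD by eventually_elim (use E'(2) in auto)
    ultimately have "exp (- \<bar>k\<bar> * B) \<le> norm (E' 0)" by (rule tendsto_lowerbound) simp
    then show ?thesis using True exp_gt_zero[of "- \<bar>k\<bar> * B"] by force
  next
    case False
    then show ?thesis using E'(2)[of z] that by (simp add: E_def P_def)
  qed
  \<comment> \<open>The zero-free extension has a logarithm on the disc. Off the puncture its
    modulus is exp (k f), so Re l = k f there.\<close>
  obtain l where l: "l holomorphic_on ball 0 1" "\<And>z. z \<in> ball 0 1 \<Longrightarrow> E' z = exp (l z)"
    using contractible_imp_holomorphic_log[OF E'(1) convex_imp_contractible[OF convex_ball] nz] by blast
  show ?thesis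
  proof (rule that[of "\<lambda>z. Re (l z / of_real k)"])
    show "harmonic_on (ball 0 1) (\<lambda>z. Re (l z / of_real k))"
      by (intro holomorphic_imp_harmonic_on_Re holomorphic_intros l) (use k in auto)
    fix z assume z: "z \<in> ?D"
    then have "exp (Re (l z)) = exp (k * f z)"
      using normE[OF z] E'(2)[OF z] l(2)[of z] norm_exp_eq_Re[of "l z"] by auto
    then show "Re (l z / of_real k) = f z" using k by simp
  qed
qed

text \<open>Comparison with \<open>t - \<epsilon> ln (2|z|)\<close>, which dominates any bounded function near \<open>0\<close>.\<close>

lemma subharmonic_punctured_disc_le:
  fixes t :: real
  assumes v: "subharmonic_on (ball 0 1 - {0}) v"
    and neg: "\<And>z. z \<in> ball 0 1 - {0} \<Longrightarrow> v z \<le> 0"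
    and circ: "\<And>z. norm z = 1 / 2 \<Longrightarrow> v z \<le> ereal t"
    and z: "z \<noteq> 0" "norm z \<le> 1 / 2"
  shows "v z \<le> ereal t"
proof -
  have eps: "v z \<le> ereal (t - \<epsilon> * ln (2 * norm z))" if \<epsilon>: "\<epsilon> > 0" for \<epsilon>
  proof -
    \<comment> \<open>The first bound places \<open>z\<close> in the annulus. The second makes t -
      \<epsilon> ln (2\<rho>) nonnegative, so it dominates \<open>v\<close> on the inner circle; on
      the outer circle |w| = 1/2 the logarithm vanishes.\<close>
    define \<rho> where "\<rho> = min (norm z / 2) (exp (t / \<epsilon>) / 2)"
    have \<rho>: "0 < \<rho>" "\<rho> < norm z" using z by (auto simp: \<rho>_def min_less_iff_disj)
    have "ln (2 * \<rho>) \<le> ln (exp (t / \<epsilon>))" using \<rho> by (subst ln_le_cancel_iff) (auto simp: \<rho>_def)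
    then have "\<epsilon> * ln (2 * \<rho>) \<le> t" using \<epsilon> by (simp add: field_simps)
    define K where "K = cball 0 (1/2) - ball (0::complex) \<rho>"
    define h where "h z = t - \<epsilon> * ln 2 - \<epsilon> * ln (norm z)" for z :: complex
    have h: "h w = t - \<epsilon> * ln (2 * norm w)" if "w \<noteq> 0" for w
      using that by (simp add: h_def ln_mult algebra_simps)
    have K: "compact K" "K \<subseteq> ball 0 1 - {0}" using \<rho> by (auto simp: K_def intro: compact_diff)
    have hh: "harmonic_on (- {0}) h"
      unfolding h_def
      by (intro harmonic_on_diff harmonic_on_const
          harmonic_on_bounded_linear[OF harmonic_on_ln_norm _ bounded_linear_mult_right]) auto
    have "v w \<le> ereal (h w)" if w: "w \<in> frontier K" for w
    proof -
      have wK: "w \<in> K" using w K(1) compact_imp_closed frontier_subset_closed by blast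
      have "w \<notin> ball 0 (1/2) - cball 0 \<rho>"
      proof
        assume "w \<in> ball 0 (1/2) - cball 0 \<rho>"
        moreover have "ball 0 (1/2) - cball 0 \<rho> \<subseteq> interior K"
          by (rule interior_maximal) (auto simp: K_def)
        ultimately show False using w by (auto simp: frontier_def)
      qed
      then consider "norm w = 1/2" | "norm w = \<rho>" using wK by (fastforce simp: K_def)
      then show ?thesis
      proof cases
        case 1
        then have "w \<noteq> 0" by auto
        then have "h w = t" using h[of w] 1 by simp
        then show ?thesis using circ[OF 1] by simp
      next
        case 2
        then have "w \<noteq> 0" using \<rho> by auto
        then have "0 \<le> h w" using h[of w] 2 \<open>\<epsilon> * ln (2 * \<rho>) \<le> t\<close> by simp
        moreover have "v w \<le> 0" using neg[of w] wK K by blast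
        ultimately show ?thesis by (meson ereal_less_eq(5) order_trans)
      qed
    qed
    moreover have "continuous_on K h" "harmonic_on (interior K) h"
      using K interior_subset[of K]
      by (auto intro!: continuous_on_subset[OF harmonic_on_imp_continuous_on[OF hh]] harmonic_on_subset[OF hh])
    moreover have "z \<in> K" using z \<rho> by (simp add: K_def)
    ultimately have "v z \<le> ereal (h z)" using v K unfolding subharmonic_on_def by blast
    then show ?thesis using h[OF z(1)] by simp
  qed
  show ?thesis
  proof (rule ccontr)
    assume "\<not> v z \<le> ereal t"
    then obtain s where s: "t < s" "ereal s < v z"
      using ereal_dense2[of "ereal t" "v z"] by (auto simp: not_le)
    \<comment> \<open>With \<epsilon> = (s - t) / b the comparison value at \<open>z\<close> is at
      most \<open>s\<close>, which lies below \<open>v z\<close>. The summand 1 keeps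
      \<open>b\<close> positive when |z| = 1/2.\<close>
    define b where "b = \<bar>ln (2 * norm z)\<bar> + 1"
    have b: "b > 0" by (simp add: b_def)
    have "ereal s < ereal (t - (s - t) / b * ln (2 * norm z))"
      using s b by (intro less_le_trans[OF s(2) eps]) simp
    moreover have "(s - t) / b * (- ln (2 * norm z)) \<le> (s - t) / b * b"
      using s b by (intro mult_left_mono) (auto simp: b_def)
    ultimately show False using b by simp
  qed
qed

section \<open>Extending conformal harmonic maps across a puncture\<close>

lemma eq_at_puncture:
  fixes \<phi> \<psi> :: "complex \<Rightarrow> 'b::t2_space"
  assumes "continuous_on (ball 0 1) \<phi>" "continuous_on (ball 0 1) \<psi>"
    and "\<And>z. z \<in> ball 0 1 - {0} \<Longrightarrow> \<phi> z = \<psi> z"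
  shows "\<phi> 0 = \<psi> 0"
proof -
  have "(\<phi> \<longlongrightarrow> \<phi> 0) (at 0)" and \<psi>: "(\<psi> \<longlongrightarrow> \<psi> 0) (at 0)"
    using assms(1,2) by (simp_all add: continuous_on_eq_continuous_at isCont_def)
  moreover have "eventually (\<lambda>z. \<psi> z = \<phi> z) (at 0)"
    by (rule eventually_mono[OF eventually_at_ball'[of 1 "0::complex" UNIV, OF zero_less_one]])
      (use assms(3) in auto)
  then have "(\<phi> \<longlongrightarrow> \<psi> 0) (at 0)" by (rule Lim_transform_eventually[OF \<psi>])
  ultimately show ?thesis using tendsto_unique[OF at_neq_bot] by blast
qed

lemma conformal_harmonic_map_extend:
  fixes f :: "complex \<Rightarrow> real ^ 'n"
  assumes n: "CARD('n) \<ge> 2" and \<Omega>: "open \<Omega>" "hyperconvex \<Omega>"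
    and f: "conformal_harmonic_map (ball 0 1 - {0}) \<Omega> f"
  obtains F where "conformal_harmonic_map (ball 0 1) \<Omega> F" "\<And>z. z \<in> ball 0 1 - {0} \<Longrightarrow> F z = f z"
proof -
  let ?D = "ball 0 1 - {0::complex}"
  have D: "open ?D" by auto
  have f\<Omega>: "f z \<in> \<Omega>" if "z \<in> ?D" for z using f that by (auto simp: conformal_harmonic_map_def)
  have conf: "conformal_on ?D f" and harm: "harmonic_on ?D f" using f by (auto simp: conformal_harmonic_map_def)
  obtain u where u: "continuous_on \<Omega> u" "MPSH_on \<Omega> u" "\<And>x. x \<in> \<Omega> \<Longrightarrow> u x < 0"
    "\<And>t::real. t < 0 \<Longrightarrow> compact {x \<in> \<Omega>. u x \<le> ereal t}"
    using \<Omega>(2) unfolding hyperconvex_def by blast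
  have sub: "subharmonic_on ?D (u \<circ> f)"
    by (rule MPSH_compose_subharmonic[OF n \<Omega>(1) u(1,2) D f])
  have S: "z \<in> ?D" if "norm z = 1/2" for z using that by auto
  have "continuous_on (sphere 0 (1/2)) (u \<circ> f)"
    using f\<Omega>[OF S] S by (intro continuous_on_compose continuous_on_subset[OF u(1)]
        continuous_on_subset[OF harmonic_on_imp_continuous_on[OF harm]]) auto
  moreover have "sphere (0::complex) (1/2) \<noteq> {}" by simp
  ultimately have "\<exists>z\<in>sphere 0 (1/2). \<forall>w\<in>sphere 0 (1/2). (u \<circ> f) w \<le> (u \<circ> f) z"
    by (intro continuous_attains_sup) auto
  then obtain zm where zm: "norm zm = 1/2" "\<And>w. norm w = 1/2 \<Longrightarrow> u (f w) \<le> u (f zm)" by auto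
  have "u (f zm) < 0" using zm S by (intro u(3) f\<Omega>)
  \<comment> \<open>The maximum over the circle may be -\<infinity>, so a real level strictly
    between it and 0 is chosen.\<close>
  then obtain t where t: "u (f zm) < ereal t" "t < 0"
    using ereal_dense2[of "u (f zm)" 0] by auto
  define C where "C = {x \<in> \<Omega>. u x \<le> ereal t}"
  have C: "compact C" "C \<subseteq> \<Omega>" using u(4)[OF t(2)] by (auto simp: C_def)
  have fC: "f z \<in> C" if z: "z \<noteq> 0" "norm z \<le> 1/2" for z
  proof -
    have "(u \<circ> f) z \<le> ereal t"
    proof (rule subharmonic_punctured_disc_le[OF sub _ _ z])
      show "(u \<circ> f) w \<le> 0" if "w \<in> ?D" for w using u(3)[OF f\<Omega>[OF that]] by simp
      show "(u \<circ> f) w \<le> ereal t" if "norm w = 1/2" for w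
        using order_trans[OF zm(2)[OF that] less_imp_le[OF t(1)]] by simp
    qed
    then show ?thesis using f\<Omega>[of z] z by (simp add: C_def)
  qed
  obtain B where B: "\<And>x. x \<in> C \<Longrightarrow> norm x \<le> B"
    using compact_imp_bounded[OF C(1)] by (auto simp: bounded_iff)
  have "\<exists>F. harmonic_on (ball 0 1) F \<and> (\<forall>z\<in>?D. F z = f z $ i)" for i
  proof (rule harmonic_removable_singularity[OF harmonic_on_nth[OF harm D], of "1/2" i B])
    show "\<bar>f z $ i\<bar> \<le> B" if "z \<in> ball 0 (1/2) - {0}" for z
      using order_trans[OF component_le_norm_cart B[OF fC]] that by simp
  qed (simp, simp, blast)
  then obtain F0 where F0: "\<And>i. harmonic_on (ball 0 1) (F0 i)" "\<And>i z. z \<in> ?D \<Longrightarrow> F0 i z = f z $ i"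
    by metis
  define F where "F z = (\<chi> i. F0 i z)" for z
  have Fh: "harmonic_on (ball 0 1) F" by (rule harmonic_on_vec) (auto simp: F_def F0)
  have Ff: "F z = f z" if "z \<in> ?D" for z using F0(2)[OF that] by (simp add: F_def vec_eq_iff)
  have "isCont F 0"
    using harmonic_on_imp_continuous_on[OF Fh] by (simp add: continuous_on_eq_continuous_at)
  moreover have "eventually (\<lambda>z. F z \<in> C) (at 0)"
    by (rule eventually_mono[OF eventually_at_ball'[of "1/2" "0::complex" UNIV]]) (use Ff fC in auto)
  \<comment> \<open>Closedness of \<open>C\<close> catches the limit at the puncture, and
    \<open>C\<close> lies inside \<Omega>.\<close>
  ultimately have "F 0 \<in> C"
    using Lim_in_closed_set[OF compact_imp_closed[OF C(1)]] unfolding isCont_def by (metis at_neq_bot)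
  then have F\<Omega>: "F \<in> ball 0 1 \<rightarrow> \<Omega>"
    using Ff f\<Omega> C by (intro Pi_I) (metis Diff_iff empty_iff insert_iff subsetD)
  have FC1: "C1_on (ball 0 1) F" using Fh by (simp add: harmonic_on_def)
  have fC1: "C1_on ?D f" using harm by (simp add: harmonic_on_def)
  have "dx F z = dx f z \<and> dy F z = dy f z" if z: "z \<in> ?D" for z
  proof -
    have "(F has_derivative (\<lambda>h. Re h *\<^sub>R dx f z + Im h *\<^sub>R dy f z)) (at z)"
      by (rule has_derivative_transform_open[OF C1_on_has_derivative[OF fC1 z] D z]) (simp add: Ff)
    then show ?thesis using has_derivative_dx_dy by blast
  qed
  then have cD: "norm (dx F z) = norm (dy F z)" "dx F z \<bullet> dy F z = 0" if "z \<in> ?D" for z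
    using conf that by (auto simp: conformal_on_def)
  have cont: "continuous_on (ball 0 1) (dx F)" "continuous_on (ball 0 1) (dy F)"
    using FC1 by (auto simp: C1_on_def)
  have "norm (dx F 0) = norm (dy F 0)"
    by (rule eq_at_puncture) (auto intro!: continuous_intros cont cD)
  moreover have "dx F 0 \<bullet> dy F 0 = 0"
    by (rule eq_at_puncture[of "\<lambda>z. dx F z \<bullet> dy F z"]) (auto intro!: continuous_intros cont cD)
  ultimately have "conformal_on (ball 0 1) F"
    unfolding conformal_on_def using FC1 cD by (smt (verit, best) Diff_iff empty_iff insert_iff)
  then show ?thesis using that Fh F\<Omega> Ff by (auto simp: conformal_harmonic_map_def)
qed

subsection \<open>Punctured compact Riemann surfaces\<close>

text \<open>With \<open>f\<close> = Re \<open>G\<close>, the modulus of exp \<open>G\<close> is exp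
  \<open>f\<close>, so the maximum modulus principle applies.\<close>

lemma harmonic_max_imp_const:
  fixes f :: "complex \<Rightarrow> real"
  assumes f: "harmonic_on (ball 0 1) f" and max: "\<And>z. z \<in> ball 0 1 \<Longrightarrow> f z \<le> f 0" and z: "z \<in> ball 0 1"
  shows "f z = f 0"
proof -
  obtain G where G: "G holomorphic_on ball 0 1" "\<And>w. w \<in> ball 0 1 \<Longrightarrow> f w = Re (G w)"
    by (rule harmonic_compose_eq_Re[OF open_ball f open_ball convex_ball holomorphic_on_ident]) auto
  have "(\<lambda>w. exp (G w)) constant_on ball 0 1"
  proof (rule maximum_modulus_principle)
    show "(\<lambda>w. exp (G w)) holomorphic_on ball 0 1" by (intro holomorphic_intros G)
    show "norm (exp (G w)) \<le> norm (exp (G 0))" if "w \<in> ball 0 1" for w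
      using max[OF that] G(2)[OF that] G(2)[of 0] by simp
  qed auto
  then have "norm (exp (G z)) = norm (exp (G 0))"
    using z unfolding constant_on_def by (metis centre_in_ball zero_less_one)
  then show ?thesis using G(2)[OF z] G(2)[of 0] by simp
qed

lemma conformal_harmonic_map_subset:
  "conformal_harmonic_map U \<Omega> f \<Longrightarrow> V \<subseteq> U \<Longrightarrow> conformal_harmonic_map V \<Omega> f"
  using harmonic_on_subset[of U f V] unfolding conformal_harmonic_map_def conformal_on_def harmonic_on_def
  by blast

text \<open>Every point is treated as if it were a puncture, so that a single statement covers the
  points of \<open>P\<close> and all others.\<close>

lemma minimal_surface_extends_locally:
  fixes f :: "'x \<Rightarrow> real ^ 'n"
  assumes n: "CARD('n) \<ge> 2" and \<Omega>: "open \<Omega>" "hyperconvex \<Omega>"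
    and X: "riemann_surface X \<A>" and P: "finite P" "P \<subseteq> topspace X"
    and f: "conformal_minimal_surface (subtopology X (topspace X - P))
              (restrict_atlas (topspace X - P) \<A>) \<Omega> f"
    and x: "x \<in> topspace X"
  obtains W \<psi> F where "openin X W" "x \<in> W" "continuous_map (subtopology X W) euclidean \<psi>"
    "\<psi> ` W = ball 0 1" "\<psi> x = (0::complex)" "harmonic_on (ball 0 1) F"
    "\<And>y. y \<in> W \<Longrightarrow> y \<noteq> x \<Longrightarrow> y \<notin> P" "\<And>y. y \<in> W \<Longrightarrow> y \<notin> P \<Longrightarrow> F (\<psi> y) = f y"
proof -
  let ?S = "topspace X - P"
  obtain U \<phi> where U: "(U, \<phi>) \<in> \<A>" "x \<in> U" using X x unfolding riemann_surface_def by blast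
  have oU: "openin X U" "open (\<phi> ` U)" and hom: "homeomorphic_map (subtopology X U) (top_of_set (\<phi> ` U)) \<phi>"
    using X U(1) unfolding riemann_surface_def by blast+
  have UX: "U \<subseteq> topspace X" using oU(1) openin_subset by blast
  have inj: "inj_on \<phi> U"
    using homeomorphic_imp_injective_map[OF hom] UX by (simp add: Int_absorb1)
  have cont: "continuous_map (subtopology X U) euclidean \<phi>"
    using homeomorphic_imp_continuous_map[OF hom] by (simp add: continuous_map_in_subtopology)
  \<comment> \<open>Since \<open>P\<close> is finite, a small coordinate disc about \<open>x\<close>
    avoids all punctures other than possibly \<open>x\<close> itself.\<close>
  have "open (\<phi> ` U - \<phi> ` (P \<inter> U - {x}))"
    using oU P by (intro open_Diff finite_imp_closed) auto
  moreover have "\<phi> x \<in> \<phi> ` U - \<phi> ` (P \<inter> U - {x})" using U inj by (auto simp: inj_on_def)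
  ultimately obtain r where r: "r > 0" "ball (\<phi> x) r \<subseteq> \<phi> ` U - \<phi> ` (P \<inter> U - {x})"
    using openE by blast
  define W where "W = {y \<in> U. \<phi> y \<in> ball (\<phi> x) r}"
  define \<psi> where "\<psi> y = (\<phi> y - \<phi> x) /\<^sub>R r" for y
  have \<phi>\<psi>: "\<phi> y = \<phi> x + r *\<^sub>R \<psi> y" for y using r by (simp add: \<psi>_def)
  let ?A = "\<lambda>z. \<phi> x + r *\<^sub>R z"
  have AW: "?A z \<in> ball (\<phi> x) r" if "z \<in> ball 0 1" for z
    using that r by (simp add: dist_norm)
  have W: "openin X W"
    using openin_continuous_map_preimage[OF cont, of "ball (\<phi> x) r"] oU(1) UX
    by (simp add: W_def openin_open_subtopology Int_absorb1)
  have xW: "x \<in> W" using U r by (simp add: W_def)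
  have WU: "W \<subseteq> U" by (auto simp: W_def)
  have "continuous_map (subtopology X W) euclidean \<phi>"
    using continuous_map_from_subtopology_mono[OF cont WU] .
  then have c\<psi>: "continuous_map (subtopology X W) euclidean \<psi>"
    using continuous_map_compose[of _ euclidean \<phi> euclidean "\<lambda>w. (w - \<phi> x) /\<^sub>R r"]
    by (simp add: o_def \<psi>_def[abs_def] continuous_intros)
  have WP: "y \<notin> P" if "y \<in> W" "y \<noteq> x" for y
    using that r by (auto simp: W_def)
  have im: "\<psi> ` W = ball 0 1"
  proof (intro equalityI subsetI)
    fix z assume "z \<in> \<psi> ` W"
    then obtain y where y: "y \<in> W" "z = \<psi> y" by blast
    have "norm (\<phi> y - \<phi> x) < r" using y(1) by (simp add: W_def dist_norm norm_minus_commute)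
    then have "norm (\<psi> y) < 1" using r(1)
      by (simp add: \<psi>_def flip: divide_inverse_commute)
    then show "z \<in> ball 0 1" using y by simp
  next
    fix z :: complex assume z: "z \<in> ball 0 1"
    then obtain y where y: "y \<in> U" "\<phi> y = ?A z" using AW[OF z] r by (metis DiffD1 image_iff subsetD)
    then have "y \<in> W" using AW[OF z] by (simp add: W_def)
    moreover have "\<psi> y = z" using y r by (simp add: \<psi>_def)
    ultimately show "z \<in> \<psi> ` W" by blast
  qed
  have "(U \<inter> ?S, \<phi>) \<in> restrict_atlas ?S \<A>" using U(1) by (force simp: restrict_atlas_def)
  then have g: "conformal_harmonic_map (\<phi> ` (U \<inter> ?S)) \<Omega> (f \<circ> inv_into (U \<inter> ?S) \<phi>)"
    using f unfolding conformal_minimal_surface_def by blast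
  let ?g = "f \<circ> inv_into (U \<inter> ?S) \<phi>"
  have "\<phi> ` (U \<inter> ?S) = \<phi> ` U - \<phi> ` (P \<inter> U)" using inj UX by (auto simp: inj_on_def)
  then have oV: "open (\<phi> ` (U \<inter> ?S))" using oU P by (simp add: open_Diff finite_imp_closed)
  define k where "k z = ?g (?A z)" for z
  have k: "conformal_harmonic_map (?A -` \<phi> ` (U \<inter> ?S)) \<Omega> k"
    unfolding k_def by (rule conformal_harmonic_map_affine[OF g oV])
  have k\<psi>: "k (\<psi> y) = f y" "\<psi> y \<in> ?A -` \<phi> ` (U \<inter> ?S)" if y: "y \<in> W" "y \<notin> P" for y
  proof -
    have yS: "y \<in> U \<inter> ?S" using y WU UX by auto
    moreover have "inj_on \<phi> (U \<inter> ?S)" using inj by (rule inj_on_subset) auto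
    ultimately show "k (\<psi> y) = f y" by (simp add: k_def \<phi>\<psi>[symmetric])
    show "\<psi> y \<in> ?A -` \<phi> ` (U \<inter> ?S)" using yS \<phi>\<psi>[of y] by (metis image_eqI vimageI)
  qed
  have \<psi>x: "\<psi> x = 0" by (simp add: \<psi>_def)
  have "ball 0 1 - {0} \<subseteq> ?A -` \<phi> ` (U \<inter> ?S)"
  proof
    fix z :: complex assume z: "z \<in> ball 0 1 - {0}"
    then obtain y where y: "y \<in> W" "z = \<psi> y" using im by blast
    then have "y \<noteq> x" using z \<psi>x by auto
    then show "z \<in> ?A -` \<phi> ` (U \<inter> ?S)" using k\<psi>(2)[OF y(1) WP[OF y(1)]] y(2) by simp
  qed
  then have kD: "conformal_harmonic_map (ball 0 1 - {0}) \<Omega> k" by (rule conformal_harmonic_map_subset[OF k])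
  then obtain F where F: "conformal_harmonic_map (ball 0 1) \<Omega> F" "\<And>z. z \<in> ball 0 1 - {0} \<Longrightarrow> F z = k z"
    using conformal_harmonic_map_extend[OF n \<Omega>] by blast
  have Fh: "harmonic_on (ball 0 1) F" using F(1) by (simp add: conformal_harmonic_map_def)
  have Ff: "F (\<psi> y) = f y" if y: "y \<in> W" "y \<notin> P" for y
  proof (cases "y = x")
    case False
    have "\<psi> y \<in> ball 0 1" using im y by blast
    moreover have "\<psi> y \<noteq> 0" using False y U inj WU r by (auto simp: \<psi>_def inj_on_def)
    ultimately show ?thesis using F(2) k\<psi>(1)[OF y] by simp
  next
    case True
    \<comment> \<open>Here \<open>x\<close> is not a puncture: \<open>k\<close> is harmonic on the
      whole disc, and continuity identifies the extension with it at the centre.\<close>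
    have "ball 0 1 \<subseteq> ?A -` \<phi> ` (U \<inter> ?S)"
    proof
      fix z :: complex assume "z \<in> ball 0 1"
      then obtain y' where "y' \<in> W" "z = \<psi> y'" using im by blast
      then show "z \<in> ?A -` \<phi> ` (U \<inter> ?S)" using k\<psi>(2) WP[of y'] y True by blast
    qed
    then have "conformal_harmonic_map (ball 0 1) \<Omega> k" by (rule conformal_harmonic_map_subset[OF k])
    then have "continuous_on (ball 0 1) k"
      by (simp add: conformal_harmonic_map_def harmonic_on_imp_continuous_on)
    then have "F 0 = k 0"
      by (rule eq_at_puncture[OF harmonic_on_imp_continuous_on[OF Fh] _ F(2)])
    then show ?thesis using k\<psi>(1)[OF y] True \<psi>x by simp
  qed
  show ?thesis by (rule that[OF W xW c\<psi> im \<psi>x Fh WP Ff])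
qed

text \<open>The local extensions glue to a map on all of \<open>X\<close>, where compactness
  provides a maximum of each component and connectedness spreads it.\<close>

lemma punctured_compact_minimal_surface_const:
  fixes f :: "'x \<Rightarrow> real ^ 'n"
  assumes n: "CARD('n) \<ge> 2" and \<Omega>: "open \<Omega>" "hyperconvex \<Omega>"
    and X: "riemann_surface X \<A>" "compact_space X" and P: "finite P" "P \<subseteq> topspace X"
    and f: "conformal_minimal_surface (subtopology X (topspace X - P))
              (restrict_atlas (topspace X - P) \<A>) \<Omega> f"
  shows "f constant_on (topspace X - P)"
proof -
  have "\<forall>x\<in>topspace X. \<exists>W \<psi> F. openin X W \<and> x \<in> W \<and> continuous_map (subtopology X W) euclidean \<psi> \<and>
    \<psi> ` W = ball 0 1 \<and> \<psi> x = (0::complex) \<and> harmonic_on (ball 0 1) F \<and>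
    (\<forall>y\<in>W. y \<noteq> x \<longrightarrow> y \<notin> P) \<and> (\<forall>y\<in>W. y \<notin> P \<longrightarrow> F (\<psi> y) = f y)"
    by (rule ballI, rule minimal_surface_extends_locally[OF n \<Omega> X(1) P f], assumption) metis
  then obtain W \<psi> F where *: "\<forall>x\<in>topspace X. openin X (W x) \<and> x \<in> W x \<and>
      continuous_map (subtopology X (W x)) euclidean (\<psi> x) \<and>
    \<psi> x ` W x = ball 0 1 \<and> \<psi> x x = (0::complex) \<and> harmonic_on (ball 0 1) (F x) \<and>
    (\<forall>y\<in>W x. y \<noteq> x \<longrightarrow> y \<notin> P) \<and> (\<forall>y\<in>W x. y \<notin> P \<longrightarrow> F x (\<psi> x y) = f y)"
    unfolding bchoice_iff by blast
  have W: "openin X (W x)" "x \<in> W x" and \<psi>: "continuous_map (subtopology X (W x)) euclidean (\<psi> x)"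
    "\<psi> x ` W x = ball 0 1" "\<psi> x x = 0" and F: "harmonic_on (ball 0 1) (F x)"
    and WP: "\<And>y. y \<in> W x \<Longrightarrow> y \<noteq> x \<Longrightarrow> y \<notin> P" and Ff: "\<And>y. y \<in> W x \<Longrightarrow> y \<notin> P \<Longrightarrow> F x (\<psi> x y) = f y"
    if "x \<in> topspace X" for x
    using * that by blast+
  \<comment> \<open>At each point, the value of that point's own extension at its centre.
    Overlapping extensions agree because a point of \<open>W x\<close> other than \<open>x\<close>
    is no puncture, so both give \<open>f\<close> there.\<close>
  define g where "g x = F x (\<psi> x x)" for x
  have gF: "g y = F x (\<psi> x y)" if x: "x \<in> topspace X" and y: "y \<in> W x" for x y
  proof (cases "y = x")
    case False
    have "y \<in> topspace X" using openin_subset[OF W(1)[OF x]] y by blast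
    then show ?thesis using WP[OF x y False] Ff[OF x y] Ff[of y y] W(2)[of y] by (simp add: g_def)
  qed (simp add: g_def)
  have gf: "g y = f y" if "y \<in> topspace X - P" for y
    using that Ff[of y y] W(2)[of y] by (simp add: g_def)
  have cg: "continuous_map X euclidean (\<lambda>y. g y $ i)" for i
  proof (rule pasting_lemma[where I = "topspace X" and T = W and f = "\<lambda>x y. F x (\<psi> x y) $ i"])
    fix x assume x: "x \<in> topspace X"
    have "continuous_on (ball 0 1) (\<lambda>z. F x z $ i)"
      by (intro continuous_intros harmonic_on_imp_continuous_on F x)
    then have 1: "continuous_map (top_of_set (ball 0 1)) euclidean (\<lambda>z. F x z $ i)" by simp
    have 2: "continuous_map (subtopology X (W x)) (top_of_set (ball 0 1)) (\<psi> x)"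
      using \<psi>(1,2)[OF x] openin_subset[OF W(1)[OF x]] by (auto simp: continuous_map_in_subtopology)
    show "continuous_map (subtopology X (W x)) euclidean (\<lambda>y. F x (\<psi> x y) $ i)"
      using continuous_map_compose[OF 2 1] by (simp add: o_def)
    show "openin X (W x)" by (rule W(1)[OF x])
    show "\<exists>j. j \<in> topspace X \<and> x \<in> W j \<and> g x $ i = F j (\<psi> j x) $ i"
      using x W(2)[OF x] by (auto simp: g_def)
  next
    fix x x' y assume "x \<in> topspace X" "x' \<in> topspace X" "y \<in> topspace X \<inter> W x \<inter> W x'"
    then show "F x (\<psi> x y) $ i = F x' (\<psi> x' y) $ i" using gF[of x y] gF[of x' y] by simp
  qed
  have "\<exists>c. \<forall>y\<in>topspace X. g y $ i = c" for i
  proof -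
    have "compact ((\<lambda>y. g y $ i) ` topspace X)"
      using image_compactin[OF _ cg, of "topspace X"] X(2) by (simp add: compact_space_def)
    moreover have "(\<lambda>y. g y $ i) ` topspace X \<noteq> {}" using X(1) by (simp add: riemann_surface_def)
    ultimately obtain x0 where x0: "x0 \<in> topspace X" "\<And>y. y \<in> topspace X \<Longrightarrow> g y $ i \<le> g x0 $ i"
      using compact_attains_sup[of "(\<lambda>y. g y $ i) ` topspace X"] by blast
    \<comment> \<open>The maximum set is closed by continuity and open by the maximum principle on
      the coordinate disc about each of its points.\<close>
    let ?T = "{y \<in> topspace X. g y $ i \<in> {g x0 $ i}}"
    have "closedin X ?T" by (rule closedin_continuous_map_preimage[OF cg]) simp
    moreover have "openin X ?T"
      unfolding openin_subopen[of X ?T]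
    proof (intro ballI exI conjI)
      fix x assume "x \<in> ?T"
      then have x: "x \<in> topspace X" "g x $ i = g x0 $ i" by auto
      show "openin X (W x)" "x \<in> W x" by (fact W[OF x(1)])+
      show "W x \<subseteq> ?T"
      proof
        fix y assume y: "y \<in> W x"
        have sub: "W x \<subseteq> topspace X" by (rule openin_subset[OF W(1)[OF x(1)]])
        have "F x (\<psi> x y) $ i = F x 0 $ i"
        proof (rule harmonic_max_imp_const[OF harmonic_on_nth[OF F[OF x(1)] open_ball]])
          show "\<psi> x y \<in> ball 0 1" using \<psi>(2)[OF x(1)] y by blast
          fix z :: complex assume "z \<in> ball 0 1"
          then obtain y' where "y' \<in> W x" "z = \<psi> x y'" using \<psi>(2)[OF x(1)] by blast
          then have "F x z $ i \<le> g x0 $ i" using gF[OF x(1), of y'] x0(2)[of y'] sub by auto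
          then show "F x z $ i \<le> F x 0 $ i" using x \<psi>(3)[OF x(1)] by (simp add: g_def)
        qed
        then show "y \<in> ?T"
          using gF[OF x(1) y] x y sub \<psi>(3)[OF x(1)] by (auto simp: g_def)
      qed
    qed
    moreover have "?T \<noteq> {}" using x0(1) by blast
    moreover have "connected_space X" using X(1) by (simp add: riemann_surface_def)
    ultimately have "?T = topspace X" unfolding connected_space_clopen_in by blast
    then show ?thesis by blast
  qed
  then obtain c where "\<And>i y. y \<in> topspace X \<Longrightarrow> g y $ i = c i" by metis
  then have "f y = (\<chi> i. c i)" if "y \<in> topspace X - P" for y
    using gf[OF that] that by (simp add: vec_eq_iff)
  then show ?thesis unfolding constant_on_def by blast
qed

theorem corollary11p4:
  fixes \<Omega> :: "(real ^ 'n) set"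
  assumes "CARD('n) \<ge> 3" and "is_domain \<Omega>" and "hyperconvex \<Omega>"
  shows "(\<forall>f. conformal_harmonic_map (ball 0 1 - {0}) \<Omega> f \<longrightarrow>
            (\<exists>F. conformal_harmonic_map (ball 0 1) \<Omega> F \<and> (\<forall>z \<in> ball 0 1 - {0}. F z = f z))) \<and>
         (\<nexists>(X :: 'x topology) \<A> P f.
            riemann_surface X \<A> \<and> compact_space X \<and> finite P \<and> P \<subseteq> topspace X \<and>
            conformal_minimal_surface (subtopology X (topspace X - P))
              (restrict_atlas (topspace X - P) \<A>) \<Omega> f \<and>
            \<not> f constant_on (topspace X - P))"
proof -
  have n: "CARD('n) \<ge> 2" using assms(1) by simp
  have \<Omega>: "open \<Omega>" using assms(2) by (simp add: is_domain_def)
  show ?thesis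
  proof (intro conjI allI impI notI)
    fix f :: "complex \<Rightarrow> real ^ 'n" assume "conformal_harmonic_map (ball 0 1 - {0}) \<Omega> f"
    from conformal_harmonic_map_extend[OF n \<Omega> assms(3) this]
    show "\<exists>F. conformal_harmonic_map (ball 0 1) \<Omega> F \<and> (\<forall>z \<in> ball 0 1 - {0}. F z = f z)" by metis
  next
    assume "\<exists>(X :: 'x topology) \<A> P f.
            riemann_surface X \<A> \<and> compact_space X \<and> finite P \<and> P \<subseteq> topspace X \<and>
            conformal_minimal_surface (subtopology X (topspace X - P))
              (restrict_atlas (topspace X - P) \<A>) \<Omega> f \<and>
            \<not> f constant_on (topspace X - P)"
    then obtain X :: "'x topology" and \<A> P f where *: "riemann_surface X \<A>" "compact_space X" "finite P"
      "P \<subseteq> topspace X" "conformal_minimal_surface (subtopology X (topspace X - P))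
        (restrict_atlas (topspace X - P) \<A>) \<Omega> f" "\<not> f constant_on (topspace X - P)"
      by (elim exE conjE)
    from punctured_compact_minimal_surface_const[OF n \<Omega> assms(3) *(1-5)] *(6) show False by contradiction
  qed
qed

end
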